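(* Let $\mathcal{X}$ be a separable topological space, let $k$ be a bounded, continuous kernel on $\mathcal{X}$, and let $P$ be a Borel probability measure on $\mathcal{X}$. Let $X_1,X_2,\dots$ be i.i.d. observations from $P$ and let $P_n=n^{-1}\sum_{i=1}^n\delta_{X_i}$ be the empirical measure. Then $$\sup_{x\in\mathcal{X}}\left|\Phi_kP_n(x)-\Phi_kP(x)\right|=O_{a.co.}\left(\sqrt{\log n/n}\right).$$
   Context: A kernel on a set $\mathcal{X}$ is a symmetric function $k\colon\mathcal{X}\times\mathcal{X}\to\mathbb{R}$ that is positive definite, i.e. $\sum_{i,j=1}^{n}a_ia_jk(x_i,x_j)\ge 0$ for all $n$, $a_i\in\mathbb{R}$, $x_i\in\mathcal{X}$; $\mathcal{H}_k$ denotes its reproducing kernel Hilbert space. For a bounded measurable kernel $k$ and a Borel probability measure $Q$ on $\mathcal{X}$, the kernel mean embedding is $\Phi_kQ=\int_{\mathcal{X}}k(\cdot,y)\,dQ(y)\in\mathcal{H}_k$ (Bochner integral), so $\Phi_kQ(x)=\int_{\mathcal{X}}k(x,y)\,dQ(y)$ and $\Phi_kP_n(x)=n^{-1}\sum_{i=1}^nk(x,X_i)$. For real random variables $Z_n$ and $Z$ and a sequence $a_n\in[0,\infty)$ converging to $0$, $Z_n-Z=O_{a.co.}(a_n)$ (almost complete convergence with rate) means that there exists $\varepsilon_0>0$ with $\sum_{n=1}^{\infty}\mathbb{P}(|Z_n-Z|>a_n\varepsilon_0)<\infty$. *)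

theory Defs
  imports "HOL-Probability.Probability"
begin

section \<open>Kernels and reproducing kernel Hilbert spaces\<close>

definition is_kernel :: "('a \<Rightarrow> 'a \<Rightarrow> real) \<Rightarrow> bool" where
  "is_kernel k \<longleftrightarrow>
     (\<forall>x y. k x y = k y x) \<and>
     (\<forall>(n::nat) (a :: nat \<Rightarrow> real) (x :: nat \<Rightarrow> 'a).
        0 \<le> (\<Sum>i=1..n. \<Sum>j=1..n. a i * a j * k (x i) (x j)))"

definition inner_norm :: "(('a \<Rightarrow> real) \<Rightarrow> ('a \<Rightarrow> real) \<Rightarrow> real) \<Rightarrow> ('a \<Rightarrow> real) \<Rightarrow> real" where
  "inner_norm ip f = sqrt (ip f f)"

text \<open>
  A Hilbert space of real functions is a set \<open>H\<close> of functions together with an inner product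
  \<open>ip\<close>, whose values matter on \<open>H\<close> only. Linear combinations are written pointwise, as there is
  no vector space instance for the function type.
\<close>

definition function_hilbert_space ::
  "('a \<Rightarrow> real) set \<Rightarrow> (('a \<Rightarrow> real) \<Rightarrow> ('a \<Rightarrow> real) \<Rightarrow> real) \<Rightarrow> bool" where
  "function_hilbert_space H ip \<longleftrightarrow>
     (\<lambda>_. 0) \<in> H \<and>
     (\<forall>f\<in>H. \<forall>g\<in>H. (\<lambda>x. f x + g x) \<in> H) \<and>
     (\<forall>c. \<forall>f\<in>H. (\<lambda>x. c * f x) \<in> H) \<and>
     (\<forall>f\<in>H. \<forall>g\<in>H. ip f g = ip g f) \<and>
     (\<forall>f\<in>H. \<forall>g\<in>H. \<forall>h\<in>H. ip (\<lambda>x. f x + g x) h = ip f h + ip g h) \<and>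
     (\<forall>c. \<forall>f\<in>H. \<forall>g\<in>H. ip (\<lambda>x. c * f x) g = c * ip f g) \<and>
     (\<forall>f\<in>H. 0 \<le> ip f f) \<and>
     (\<forall>f\<in>H. ip f f = 0 \<longrightarrow> f = (\<lambda>_. 0)) \<and>
     (\<forall>f :: nat \<Rightarrow> 'a \<Rightarrow> real.
        (\<forall>n. f n \<in> H) \<longrightarrow>
        (\<forall>e>0. \<exists>N. \<forall>m\<ge>N. \<forall>n\<ge>N. inner_norm ip (\<lambda>x. f m x - f n x) < e) \<longrightarrow>
        (\<exists>g\<in>H. (\<lambda>n. inner_norm ip (\<lambda>x. f n x - g x)) \<longlonglongrightarrow> 0))"

text \<open>
  By the Moore-Aronszajn theorem, every kernel \<open>k\<close> has exactly one such \<open>H\<close>, with \<open>ip\<close> uniquely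
  determined on \<open>H\<close>.
\<close>

definition is_rkhs ::
  "('a \<Rightarrow> 'a \<Rightarrow> real) \<Rightarrow> ('a \<Rightarrow> real) set \<Rightarrow> (('a \<Rightarrow> real) \<Rightarrow> ('a \<Rightarrow> real) \<Rightarrow> real) \<Rightarrow> bool" where
  "is_rkhs k H ip \<longleftrightarrow>
     function_hilbert_space H ip \<and>
     (\<forall>x. (\<lambda>z. k z x) \<in> H) \<and>
     (\<forall>f\<in>H. \<forall>x. f x = ip f (\<lambda>z. k z x))"


section \<open>Bochner integral and kernel mean embedding\<close>

text \<open>
  The Bochner integral of the library needs a Banach space given as a type, whereas an RKHS is a
  set depending on \<open>k\<close>. The following definitions repeat the library's construction for functions
  with values in \<open>(H, ip)\<close> and finite measures \<open>Q\<close>. Measurability is required of the norms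
  \<open>\<parallel>F - s\<^sub>n\<parallel>\<close>: otherwise their nonnegative integral would only be a lower integral. Together with its
  convergence to \<open>0\<close> this makes \<open>F\<close> an almost everywhere limit of simple functions.
\<close>

definition simple_function_integral :: "'b measure \<Rightarrow> ('b \<Rightarrow> 'a \<Rightarrow> real) \<Rightarrow> 'a \<Rightarrow> real" where
  "simple_function_integral Q s =
     (\<lambda>x. \<Sum>v\<in>s ` space Q. measure Q {y \<in> space Q. s y = v} * v x)"

definition has_bochner_integral_in ::
  "('a \<Rightarrow> real) set \<Rightarrow> (('a \<Rightarrow> real) \<Rightarrow> ('a \<Rightarrow> real) \<Rightarrow> real) \<Rightarrow>
   'b measure \<Rightarrow> ('b \<Rightarrow> 'a \<Rightarrow> real) \<Rightarrow> ('a \<Rightarrow> real) \<Rightarrow> bool" where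
  "has_bochner_integral_in H ip Q F h \<longleftrightarrow>
     h \<in> H \<and> (\<forall>y\<in>space Q. F y \<in> H) \<and>
     (\<exists>s :: nat \<Rightarrow> 'b \<Rightarrow> 'a \<Rightarrow> real.
        (\<forall>n. simple_function Q (s n) \<and> s n ` space Q \<subseteq> H) \<and>
        (\<forall>n. (\<lambda>y. inner_norm ip (\<lambda>x. F y x - s n y x)) \<in> borel_measurable Q) \<and>
        (\<lambda>n. \<integral>\<^sup>+ y. ennreal (inner_norm ip (\<lambda>x. F y x - s n y x)) \<partial>Q) \<longlonglongrightarrow> 0 \<and>
        (\<lambda>n. inner_norm ip (\<lambda>x. simple_function_integral Q (s n) x - h x)) \<longlonglongrightarrow> 0)"

definition kernel_mean_embedding ::
  "('a \<Rightarrow> real) set \<Rightarrow> (('a \<Rightarrow> real) \<Rightarrow> ('a \<Rightarrow> real) \<Rightarrow> real) \<Rightarrow>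
   ('a \<Rightarrow> 'a \<Rightarrow> real) \<Rightarrow> 'a measure \<Rightarrow> 'a \<Rightarrow> real" where
  "kernel_mean_embedding H ip k Q =
     (THE h. has_bochner_integral_in H ip Q (\<lambda>y x. k x y) h)"


section \<open>Empirical measures\<close>

definition empirical_measure :: "(nat \<Rightarrow> 'a::topological_space) \<Rightarrow> nat \<Rightarrow> 'a measure" where
  "empirical_measure x n =
     measure_of UNIV (sets borel)
       (\<lambda>A. (\<Sum>i=1..n. emeasure (return borel (x i)) A) / of_nat n)"

lemma sets_empirical_measure [simp]: "sets (empirical_measure x n) = sets borel"
  unfolding empirical_measure_def
  by (metis sets.sigma_sets_eq sets_measure_of space_borel top_greatest Pow_UNIV)

lemma emeasure_empirical_measure:
  assumes "A \<in> sets borel"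
  shows "emeasure (empirical_measure x n) A
           = (\<Sum>i=1..n. emeasure (return borel (x i)) A) / of_nat n"
proof (rule emeasure_measure_of[OF empirical_measure_def])
  show "countably_additive (sets (empirical_measure x n))
          (\<lambda>A. (\<Sum>i=1..n. emeasure (return borel (x i)) A) / of_nat n)"
  proof (rule countably_additiveI)
    fix B :: "nat \<Rightarrow> 'a set"
    assume B: "range B \<subseteq> sets (empirical_measure x n)" "disjoint_family B"
    have "(\<Sum>j. (\<Sum>i=1..n. emeasure (return borel (x i)) (B j)) / of_nat n)
            = (\<Sum>j. \<Sum>i=1..n. emeasure (return borel (x i)) (B j)) / of_nat n"
      by (simp add: divide_ennreal_def)
    also have "(\<Sum>j. \<Sum>i=1..n. emeasure (return borel (x i)) (B j))
            = (\<Sum>i=1..n. \<Sum>j. emeasure (return borel (x i)) (B j))"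
      by (rule suminf_sum) simp
    also have "\<dots> = (\<Sum>i=1..n. emeasure (return borel (x i)) (\<Union>j. B j))"
      using B by (intro sum.cong refl suminf_emeasure) auto
    finally show "(\<Sum>j. (\<Sum>i=1..n. emeasure (return borel (x i)) (B j)) / of_nat n)
            = (\<Sum>i=1..n. emeasure (return borel (x i)) (\<Union>j. B j)) / of_nat n" .
  qed
qed (use assms in \<open>auto simp: positive_def\<close>)


section \<open>Almost complete convergence with rate\<close>

text \<open>
  \<open>Z\<^sub>n - Z = O\<^sub>a\<^sub>.\<^sub>c\<^sub>.(a\<^sub>n)\<close> for sequences indexed by \<open>n \<ge> 1\<close>. Measurability belongs to the
  definition, because \<open>measure\<close> is \<open>0\<close> on non-measurable sets.
\<close>

definition bigo_aco ::
  "'w measure \<Rightarrow> (nat \<Rightarrow> 'w \<Rightarrow> real) \<Rightarrow> ('w \<Rightarrow> real) \<Rightarrow> (nat \<Rightarrow> real) \<Rightarrow> bool" where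
  "bigo_aco M Z Z' a \<longleftrightarrow>
     (\<forall>n\<ge>1. Z n \<in> borel_measurable M) \<and> Z' \<in> borel_measurable M \<and>
     (\<forall>n\<ge>1. 0 \<le> a n) \<and> a \<longlonglongrightarrow> 0 \<and>
     (\<exists>\<epsilon>>0. summable (\<lambda>n. measure M
        {\<omega> \<in> space M. \<bar>Z (Suc n) \<omega> - Z' \<omega>\<bar> > a (Suc n) * \<epsilon>}))"

end

theory Submission
  imports Defs
begin

text \<open>
  The centred sections \<open>\<psi> x = k(\<cdot>, x) - \<Phi>\<^sub>k P\<close> have mean zero in the RKHS, and by the reproducing
  property the supremum is at most a constant times the norm of \<open>S\<^sub>n / n\<close>, where
  \<open>S\<^sub>n = \<psi> (X\<^sub>1) + \<dots> + \<psi> (X\<^sub>n)\<close>. Convexity of \<open>t \<mapsto> cosh (sqrt t)\<close> gives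
  \<open>E cosh (l * \<parallel>S\<^sub>n\<parallel>) \<le> (cosh (l * B))\<^sup>n\<close> for a bound \<open>B\<close> of the norms \<open>\<parallel>\<psi> x\<parallel>\<close>, whence a
  sub-Gaussian tail for \<open>\<parallel>S\<^sub>n\<parallel>\<close>, which at the rate \<open>sqrt (ln n / n)\<close> is summable. Separability
  reduces the supremum to a countable set and makes \<open>k\<close> measurable for the product
  \<open>\<sigma>\<close>-algebra.
\<close>

section \<open>The function \<open>cosh (sqrt t)\<close>: power series and a convexity
  inequality\<close>

text \<open>Only even powers survive in the series of \<open>cosh\<close>, and even powers of
  \<open>sqrt t\<close> are powers of \<open>t\<close>. Inequalities for
  \<open>cosh (sqrt t)\<close> can therefore be checked term by term, with nonnegative
  coefficients.\<close>

lemma cosh_sqrt_sums: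
  fixes t :: real
  assumes "0 \<le> t"
  shows "(\<lambda>n. t ^ n / fact (2 * n)) sums cosh (sqrt t)"
proof -
  have "(\<lambda>n. (\<lambda>m. if even m then sqrt t ^ m /\<^sub>R fact m else 0) (2 * n)) sums cosh (sqrt t)"
    by (subst sums_mono_reindex)
       (use cosh_converges[of "sqrt t"] in \<open>auto simp: strict_mono_def elim!: evenE\<close>)
  moreover have "sqrt t ^ (2 * n) = t ^ n" for n
    using assms by (simp add: power_mult)
  ultimately show ?thesis
    by (simp add: divide_inverse mult.commute)
qed

text \<open>Termwise this is \<open>fact n \<le> fact (2 * n)\<close>. A sharper exponent would only
  improve a constant in the tail bound.\<close>

lemma cosh_le_exp_square:
  fixes x :: real
  shows "cosh x \<le> exp (x\<^sup>2)"
proof -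
  have "(\<lambda>n. (x\<^sup>2) ^ n / fact (2 * n)) sums cosh \<bar>x\<bar>"
    using cosh_sqrt_sums[of "x\<^sup>2"] by simp
  moreover have "(\<lambda>n. (x\<^sup>2) ^ n / fact n) sums exp (x\<^sup>2)"
    using exp_converges[of "x\<^sup>2"] by (simp add: divide_inverse mult.commute)
  ultimately have "cosh \<bar>x\<bar> \<le> exp (x\<^sup>2)"
    by (rule sums_le[rotated]) (auto intro!: divide_left_mono fact_mono)
  then show ?thesis
    by simp
qed

text \<open>
  The function \<open>t \<mapsto> cosh (sqrt t)\<close> is convex and increasing, being a power series with nonnegative
  coefficients, and \<open>a\<^sup>2 + B\<^sup>2 + 2 * c\<close> is a convex combination of \<open>(a + B)\<^sup>2\<close> and \<open>(a - B)\<^sup>2\<close>.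
\<close>

lemma cosh_sqrt_add_le:
  fixes a b c B :: real
  assumes a: "0 \<le> a" and B: "0 \<le> B" and b: "b \<le> B\<^sup>2" and c: "\<bar>c\<bar> \<le> a * B"
    and nn: "0 \<le> a\<^sup>2 + 2 * c + b"
  shows "cosh (sqrt (a\<^sup>2 + 2 * c + b)) \<le> cosh a * cosh B + c * (sinh a / a * (sinh B / B))"
proof -
  \<comment> \<open>The position of \<open>c\<close> between \<open>- (a * B)\<close> and
    \<open>a * B\<close>, like the cosine of an angle. If \<open>a * B = 0\<close>, then
    \<open>c = 0\<close> too and division by zero gives \<open>r = 0\<close>, so \<open>rc\<close>
    still holds.\<close>
  define r where "r = c / (a * B)"
  have r: "\<bar>r\<bar> \<le> 1"
    using a B c by (cases "a * B = 0") (auto simp: r_def abs_mult divide_le_eq_1)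
  have rc: "r * (a * B) = c"
    using c by (cases "a * B = 0") (auto simp: r_def)
  define p where "p = (1 + r) / 2"
  define q where "q = (1 - r) / 2"
  have pq: "0 \<le> p" "0 \<le> q" "p + q = 1"
    using r by (auto simp: p_def q_def field_simps)
  have comb: "p * (a + B)\<^sup>2 + q * (a - B)\<^sup>2 = a\<^sup>2 + 2 * c + B\<^sup>2"
    unfolding p_def q_def rc[symmetric] by (simp add: field_simps power2_eq_square)
  have conv: "(p * x + q * y) ^ n \<le> p * x ^ n + q * y ^ n" if "0 \<le> x" "0 \<le> y" for x y :: real and n
  proof -
    have "convex_on {0..} (\<lambda>x::real. x ^ n)"
      by (cases "even n") (auto intro: convex_on_subset[OF convex_power_even] convex_power_odd)
    from convex_onD[OF this, of q x y] that pq show ?thesis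
      by (simp add: eq_diff_eq[symmetric])
  qed
  have "cosh (sqrt (a\<^sup>2 + 2 * c + b)) \<le> p * cosh \<bar>a + B\<bar> + q * cosh \<bar>a - B\<bar>"
  proof (rule sums_le)
    show "(\<lambda>n. (a\<^sup>2 + 2 * c + b) ^ n / fact (2 * n)) sums cosh (sqrt (a\<^sup>2 + 2 * c + b))"
      using nn by (rule cosh_sqrt_sums)
    have "(\<lambda>n. p * (((a + B)\<^sup>2) ^ n / fact (2 * n)) + q * (((a - B)\<^sup>2) ^ n / fact (2 * n)))
        sums (p * cosh (sqrt ((a + B)\<^sup>2)) + q * cosh (sqrt ((a - B)\<^sup>2)))"
      by (intro sums_add sums_mult cosh_sqrt_sums) auto
    then show "(\<lambda>n. (p * ((a + B)\<^sup>2) ^ n + q * ((a - B)\<^sup>2) ^ n) / fact (2 * n))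
        sums (p * cosh \<bar>a + B\<bar> + q * cosh \<bar>a - B\<bar>)"
      by (simp add: add_divide_distrib)
    fix n
    \<comment> \<open>Raising \<open>b\<close> to \<open>B\<^sup>2\<close> preserves the order of
      the powers, as the smaller base is nonnegative; then \<open>comb\<close> applies.\<close>
    have "(a\<^sup>2 + 2 * c + b) ^ n \<le> (a\<^sup>2 + 2 * c + B\<^sup>2) ^ n"
      using nn b by (intro power_mono) auto
    also have "\<dots> \<le> p * ((a + B)\<^sup>2) ^ n + q * ((a - B)\<^sup>2) ^ n"
      unfolding comb[symmetric] by (rule conv) auto
    finally show "(a\<^sup>2 + 2 * c + b) ^ n / fact (2 * n)
        \<le> (p * ((a + B)\<^sup>2) ^ n + q * ((a - B)\<^sup>2) ^ n) / fact (2 * n)"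
      by (intro divide_right_mono) auto
  qed
  also have "\<dots> = (p + q) * (cosh a * cosh B) + (p - q) * (sinh a * sinh B)"
    by (simp add: cosh_add cosh_diff algebra_simps)
  \<comment> \<open>Here \<open>p - q = r\<close>, and the denominator \<open>a * B\<close> of
    \<open>r\<close> is distributed over the two \<open>sinh\<close> factors.\<close>
  also have "\<dots> = cosh a * cosh B + c * (sinh a / a * (sinh B / B))"
    using pq by (simp add: p_def q_def r_def field_simps)
  finally show ?thesis .
qed

section \<open>Hilbert spaces of functions\<close>

locale function_hilbert =
  fixes H :: "('a \<Rightarrow> real) set" and ip :: "('a \<Rightarrow> real) \<Rightarrow> ('a \<Rightarrow> real) \<Rightarrow> real"
  assumes function_hilbert_space: "function_hilbert_space H ip"
begin

abbreviation "nrm \<equiv> inner_norm ip"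

lemma zero_mem: "(\<lambda>_. 0) \<in> H"
  and add_mem: "f \<in> H \<Longrightarrow> g \<in> H \<Longrightarrow> (\<lambda>x. f x + g x) \<in> H"
  and scale_mem: "f \<in> H \<Longrightarrow> (\<lambda>x. c * f x) \<in> H"
  and ip_commute: "f \<in> H \<Longrightarrow> g \<in> H \<Longrightarrow> ip f g = ip g f"
  and ip_add_left: "f \<in> H \<Longrightarrow> g \<in> H \<Longrightarrow> h \<in> H \<Longrightarrow> ip (\<lambda>x. f x + g x) h = ip f h + ip g h"
  and ip_scale_left: "f \<in> H \<Longrightarrow> g \<in> H \<Longrightarrow> ip (\<lambda>x. c * f x) g = c * ip f g"
  and ip_nonneg: "f \<in> H \<Longrightarrow> 0 \<le> ip f f"
  and ip_definite: "f \<in> H \<Longrightarrow> ip f f = 0 \<Longrightarrow> f = (\<lambda>_. 0)"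
  using function_hilbert_space unfolding function_hilbert_space_def by blast+

lemma complete:
  assumes "\<And>n. f n \<in> H"
    and "\<And>e. e > 0 \<Longrightarrow> \<exists>N. \<forall>m\<ge>N. \<forall>n\<ge>N. nrm (\<lambda>x. f m x - f n x) < e"
  obtains g where "g \<in> H" "(\<lambda>n. nrm (\<lambda>x. f n x - g x)) \<longlonglongrightarrow> 0"
proof -
  have "\<forall>f. (\<forall>n. f n \<in> H) \<longrightarrow>
      (\<forall>e>0. \<exists>N. \<forall>m\<ge>N. \<forall>n\<ge>N. nrm (\<lambda>x. f m x - f n x) < e) \<longrightarrow>
      (\<exists>g\<in>H. (\<lambda>n. nrm (\<lambda>x. f n x - g x)) \<longlonglongrightarrow> 0)"
    using function_hilbert_space unfolding function_hilbert_space_def by (elim conjE) assumption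
  from this[rule_format, OF assms] show ?thesis
    by (auto intro: that)
qed

lemma diff_mem: "f \<in> H \<Longrightarrow> g \<in> H \<Longrightarrow> (\<lambda>x. f x - g x) \<in> H"
  using add_mem[OF _ scale_mem, of f g "- 1"] by simp

lemma ip_diff_left: "f \<in> H \<Longrightarrow> g \<in> H \<Longrightarrow> h \<in> H \<Longrightarrow> ip (\<lambda>x. f x - g x) h = ip f h - ip g h"
  using ip_add_left[OF _ scale_mem, of f g h "- 1"] ip_scale_left[of g h "- 1"] by simp

lemma ip_diff_right: "f \<in> H \<Longrightarrow> g \<in> H \<Longrightarrow> h \<in> H \<Longrightarrow> ip h (\<lambda>x. f x - g x) = ip h f - ip h g"
  by (simp add: ip_commute[of h] diff_mem ip_diff_left)

lemma ip_scale_right: "f \<in> H \<Longrightarrow> g \<in> H \<Longrightarrow> ip g (\<lambda>x. c * f x) = c * ip g f"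
  by (simp add: ip_commute[of g] scale_mem ip_scale_left)

lemma ip_zero_left: "f \<in> H \<Longrightarrow> ip (\<lambda>_. 0) f = 0"
  using ip_scale_left[of f f 0] by simp

lemma sum_mem: "(\<And>i. i \<in> I \<Longrightarrow> f i \<in> H) \<Longrightarrow> (\<lambda>x. \<Sum>i\<in>I. f i x) \<in> H"
  by (induction I rule: infinite_finite_induct) (auto simp: zero_mem add_mem)

lemma ip_sum_left:
  "(\<And>i. i \<in> I \<Longrightarrow> f i \<in> H) \<Longrightarrow> g \<in> H \<Longrightarrow> ip (\<lambda>x. \<Sum>i\<in>I. f i x) g = (\<Sum>i\<in>I. ip (f i) g)"
  by (induction I rule: infinite_finite_induct) (auto simp: ip_zero_left ip_add_left sum_mem)

lemma nrm_nonneg: "f \<in> H \<Longrightarrow> 0 \<le> nrm f"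
  by (simp add: inner_norm_def ip_nonneg)

lemma nrm_square: "f \<in> H \<Longrightarrow> (nrm f)\<^sup>2 = ip f f"
  by (simp add: inner_norm_def ip_nonneg)

lemma Cauchy_Schwarz:
  assumes f: "f \<in> H" and g: "g \<in> H"
  shows "\<bar>ip f g\<bar> \<le> nrm f * nrm g"
proof (cases "ip g g = 0")
  case True
  then have "ip g f = 0"
    using ip_definite[OF g] ip_zero_left[OF f] by simp
  then show ?thesis
    using f g by (simp add: ip_commute[OF f g] nrm_nonneg)
next
  case False
  \<comment> \<open>The minimiser of the squared norm of \<open>f - t * g\<close>.\<close>
  define t where "t = ip f g / ip g g"
  have "0 \<le> ip (\<lambda>x. f x - t * g x) (\<lambda>x. f x - t * g x)"
    using f g by (intro ip_nonneg diff_mem scale_mem)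
  also have "\<dots> = ip f f - 2 * t * ip f g + t * t * ip g g"
    using f g by (simp add: ip_diff_left ip_diff_right diff_mem scale_mem ip_scale_left
        ip_scale_right ip_commute[OF g f] algebra_simps)
  also have "\<dots> = ip f f - (ip f g)\<^sup>2 / ip g g"
    using False by (simp add: t_def field_simps power2_eq_square)
  finally have "(ip f g)\<^sup>2 \<le> ip f f * ip g g"
    using False ip_nonneg[OF g] by (simp add: field_simps)
  then have "\<bar>ip f g\<bar> \<le> sqrt (ip f f * ip g g)"
    by (rule real_le_rsqrt[of "\<bar>_\<bar>", simplified])
  then show ?thesis
    by (simp add: inner_norm_def real_sqrt_mult)
qed

section \<open>Integrals of simple functions with values in \<open>H\<close>\<close>

lemma simple_function_integral_mem:
  assumes "s ` space Q \<subseteq> H"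
  shows "simple_function_integral Q s \<in> H"
  unfolding simple_function_integral_def using assms by (intro sum_mem scale_mem) auto

text \<open>A simple function is a finite sum over its level sets, and \<open>ip\<close> commutes
  with finite sums. Pairing with \<open>g\<close> thus turns the function-valued integral into a
  scalar one.\<close>

lemma simple_function_integral_inner:
  assumes Q: "finite_measure Q" and s: "simple_function Q s" "s ` space Q \<subseteq> H" and g: "g \<in> H"
  shows "integrable Q (\<lambda>y. ip (s y) g)"
    and "ip (simple_function_integral Q s) g = (\<integral>y. ip (s y) g \<partial>Q)"
proof -
  interpret finite_measure Q by fact
  have A: "{y \<in> space Q. s y = v} \<in> sets Q" for v
    using simple_functionD(2)[OF s(1), of "{v}"] by (simp add: vimage_def Int_def conj_commute)
  have eq: "ip (s y) g = (\<Sum>v\<in>s ` space Q. indicator {y \<in> space Q. s y = v} y * ip v g)"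
    if "y \<in> space Q" for y
  proof -
    have "(\<Sum>v\<in>s ` space Q. indicator {y \<in> space Q. s y = v} y * ip v g)
        = (\<Sum>v\<in>s ` space Q. if v = s y then ip v g else 0)"
      using that by (intro sum.cong) (auto simp: indicator_def)
    then show ?thesis
      using that simple_functionD(1)[OF s(1)] by simp
  qed
  have int: "integrable Q (\<lambda>y. indicator {y \<in> space Q. s y = v} y * ip v g)" for v
    using A[of v] by (intro integrable_mult_left integrable_real_indicator) (auto simp: less_top[symmetric])
  have "integrable Q (\<lambda>y. \<Sum>v\<in>s ` space Q. indicator {y \<in> space Q. s y = v} y * ip v g)"
    by (intro Bochner_Integration.integrable_sum int)
  then show "integrable Q (\<lambda>y. ip (s y) g)"
    by (subst Bochner_Integration.integrable_cong[OF refl eq])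
  have "(\<integral>y. ip (s y) g \<partial>Q)
      = (\<integral>y. (\<Sum>v\<in>s ` space Q. indicator {y \<in> space Q. s y = v} y * ip v g) \<partial>Q)"
    by (intro Bochner_Integration.integral_cong refl eq)
  also have "\<dots> = (\<Sum>v\<in>s ` space Q. \<integral>y. indicator {y \<in> space Q. s y = v} y * ip v g \<partial>Q)"
    by (intro Bochner_Integration.integral_sum int)
  also have "\<dots> = (\<Sum>v\<in>s ` space Q. measure Q {y \<in> space Q. s y = v} * ip v g)"
    using A by (intro sum.cong refl) (simp add: Int_def conj_ac)
  also have "\<dots> = ip (simple_function_integral Q s) g"
    unfolding simple_function_integral_def
    using s g by (subst ip_sum_left) (auto intro!: scale_mem sum.cong simp: ip_scale_left[symmetric] subset_eq)
  finally show "ip (simple_function_integral Q s) g = (\<integral>y. ip (s y) g \<partial>Q)" ..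
qed

end

lemma separable_space_dense_sequence:
  assumes "separable_space (euclidean :: 'a::topological_space topology)"
  obtains d :: "nat \<Rightarrow> 'a::topological_space" where "\<And>x S. open S \<Longrightarrow> x \<in> S \<Longrightarrow> \<exists>n. d n \<in> S"
proof -
  obtain D :: "'a set" where D: "countable D" "closure D = UNIV"
    using assms by (auto simp: separable_space_def)
  \<comment> \<open>The type is inhabited, so its dense subset is nonempty, which
    \<open>from_nat_into\<close> requires in order to enumerate exactly \<open>D\<close>.\<close>
  then have "D \<noteq> {}"
    by auto
  with D(1) have "range (from_nat_into D) = D"
    by (rule range_from_nat_into[rotated])
  moreover have "D \<inter> S \<noteq> {}" if "open S" "x \<in> S" for x S
    using D(2) that open_Int_closure_eq_empty[of S D] by auto
  ultimately show ?thesis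
    by (intro that[of "from_nat_into D"]) (metis disjoint_iff rangeE)
qed

section \<open>Reproducing kernel Hilbert spaces of bounded continuous kernels\<close>

locale continuous_rkhs = function_hilbert H ip
  for H :: "('a::topological_space \<Rightarrow> real) set" and ip +
  fixes k :: "'a \<Rightarrow> 'a \<Rightarrow> real" and C :: real and d :: "nat \<Rightarrow> 'a"
  assumes section_mem: "(\<lambda>z. k z x) \<in> H"
    and reproducing: "f \<in> H \<Longrightarrow> f x = ip f (\<lambda>z. k z x)"
    and kernel_bound: "\<bar>k x y\<bar> \<le> C"
    and C_pos: "0 < C"
    and kernel_continuous: "continuous_on UNIV (\<lambda>(x, y). k x y)"
    and dense: "open S \<Longrightarrow> x \<in> S \<Longrightarrow> \<exists>n. d n \<in> S"
begin

text \<open>The pseudometric pulled back from \<open>H\<close> along the feature map. It is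
  continuous, and so stands in for a metric on a space that need not carry one.\<close>

definition kdist :: "'a \<Rightarrow> 'a \<Rightarrow> real" where
  "kdist x y = nrm (\<lambda>z. k z x - k z y)"

lemma ip_sections: "ip (\<lambda>z. k z x) (\<lambda>z. k z y) = k y x"
  by (rule reproducing[OF section_mem[of x], of y, symmetric])

lemma kernel_sym: "k x y = k y x"
  using ip_commute[OF section_mem section_mem, of x y] by (simp add: ip_sections)

lemma kdist_eq: "kdist x y = sqrt (k x x - 2 * k x y + k y y)"
  unfolding kdist_def inner_norm_def
  by (simp add: ip_diff_left ip_diff_right diff_mem section_mem ip_sections kernel_sym[of y x])

lemma kdist_nonneg: "0 \<le> kdist x y"
  by (simp add: kdist_def nrm_nonneg diff_mem section_mem)

lemma kdist_le: "kdist x y \<le> sqrt (4 * C)"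
  unfolding kdist_eq
  using kernel_bound[of x x] kernel_bound[of x y] kernel_bound[of y y] by (intro real_sqrt_le_mono) auto

lemma kdist_self [simp]: "kdist x x = 0"
  by (simp add: kdist_eq)

lemma nrm_section: "nrm (\<lambda>z. k z x) \<le> sqrt C"
  using kernel_bound[of x x] by (simp add: inner_norm_def ip_sections)

lemma mem_bound:
  assumes "f \<in> H"
  shows "\<bar>f x\<bar> \<le> nrm f * sqrt C"
  using Cauchy_Schwarz[OF assms section_mem, of x]
    mult_left_mono[OF nrm_section nrm_nonneg[OF assms], of x]
  unfolding reproducing[OF assms, of x, symmetric] by (rule order_trans)

text \<open>By the reproducing property, \<open>f x - f y\<close> is the pairing of \<open>f\<close>
  with a difference of sections. Members of \<open>H\<close> are thus Lipschitz for
  \<open>kdist\<close>, which gives their continuity and the approximation by dense points.\<close>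

lemma mem_dist_le: "f \<in> H \<Longrightarrow> \<bar>f x - f y\<bar> \<le> nrm f * kdist x y"
  using Cauchy_Schwarz[OF _ diff_mem[OF section_mem section_mem], of f x y]
  by (simp add: ip_diff_right section_mem kdist_def flip: reproducing)

lemma continuous_on_kernel_compose [continuous_intros]:
  assumes "continuous_on A f" "continuous_on A g"
  shows "continuous_on A (\<lambda>x. k (f x) (g x))"
  using continuous_on_compose2[OF kernel_continuous continuous_on_Pair[OF assms]] by simp

lemma continuous_on_kdist: "continuous_on UNIV (\<lambda>x. kdist x y)"
  unfolding kdist_eq by (intro continuous_intros)

lemma mem_continuous:
  assumes "f \<in> H"
  shows "continuous_on UNIV f"
  unfolding continuous_on
proof
  fix x :: 'a
  have "((\<lambda>z. kdist z x) \<longlongrightarrow> kdist x x) (at x)"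
    using continuous_on_kdist[of x] unfolding continuous_on by blast
  then have "((\<lambda>z. nrm f * kdist z x) \<longlongrightarrow> 0) (at x)"
    by (intro tendsto_mult_right_zero) simp
  then have "((\<lambda>z. f z - f x) \<longlongrightarrow> 0) (at x)"
    by (rule Lim_null_comparison[rotated]) (use mem_dist_le[OF assms] in auto)
  then show "(f \<longlongrightarrow> f x) (at x)"
    by (simp add: LIM_zero_iff)
qed

lemma mem_measurable: "f \<in> H \<Longrightarrow> f \<in> borel_measurable borel"
  by (intro borel_measurable_continuous_onI mem_continuous)

lemma mem_integrable:
  assumes "f \<in> H" "finite_measure Q" "sets Q = sets borel"
  shows "integrable Q f"
proof (rule finite_measure.integrable_const_bound[OF assms(2)])
  show "AE x in Q. norm (f x) \<le> nrm f * sqrt C"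
    using mem_bound[OF assms(1)] by simp
  show "f \<in> borel_measurable Q"
    using mem_measurable[OF assms(1)] by (simp add: measurable_cong_sets[OF assms(3) refl])
qed

section \<open>Measurable approximation by a dense sequence\<close>

text \<open>Taking the least index breaks ties, so that the choice of a closest point among the
  first \<open>n + 1\<close> points is unique and measurable.\<close>

definition nearest :: "nat \<Rightarrow> 'a \<Rightarrow> nat" where
  "nearest n y = (LEAST i. i \<le> n \<and> (\<forall>l\<in>{..n}. kdist y (d i) \<le> kdist y (d l)))"

lemma nearest_le: "nearest n y \<le> n"
  and kdist_nearest_le: "l \<le> n \<Longrightarrow> kdist y (d (nearest n y)) \<le> kdist y (d l)"
proof -
  obtain i where "i \<le> n" "\<forall>l\<in>{..n}. kdist y (d i) \<le> kdist y (d l)"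
    using ex_is_arg_min_if_finite[of "{..n}" "\<lambda>l. kdist y (d l)"]
    by (auto simp: is_arg_min_linorder)
  then have "nearest n y \<le> n \<and> (\<forall>l\<in>{..n}. kdist y (d (nearest n y)) \<le> kdist y (d l))"
    unfolding nearest_def
    by (intro LeastI[of "\<lambda>i. i \<le> n \<and> (\<forall>l\<in>{..n}. kdist y (d i) \<le> kdist y (d l))"] conjI)
  then show "nearest n y \<le> n" "l \<le> n \<Longrightarrow> kdist y (d (nearest n y)) \<le> kdist y (d l)"
    by auto
qed

lemma measurable_kdist [measurable]: "(\<lambda>y. kdist y x) \<in> borel_measurable borel"
  by (intro borel_measurable_continuous_onI continuous_on_kdist)

lemma measurable_nearest [measurable]: "nearest n \<in> measurable borel (count_space UNIV)"
  unfolding nearest_def by measurable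

text \<open>Balls of \<open>kdist\<close> are open and so contain some \<open>d i\<close>; from
  \<open>n = i\<close> on, the nearest point is at least as close.\<close>

lemma kdist_nearest_tendsto: "(\<lambda>n. kdist y (d (nearest n y))) \<longlonglongrightarrow> 0"
proof (rule LIMSEQ_I)
  fix r :: real
  assume "0 < r"
  have "continuous_on UNIV (\<lambda>x. kdist y x)"
    unfolding kdist_eq by (intro continuous_intros)
  then have "open {x. kdist y x < r}"
    by (intro open_Collect_less continuous_intros)
  then obtain i where i: "kdist y (d i) < r"
    using dense[of "{x. kdist y x < r}" y] \<open>0 < r\<close> by auto
  have "norm (kdist y (d (nearest n y)) - 0) < r" if "i \<le> n" for n
    using kdist_nearest_le[OF that, of y] i kdist_nonneg[of y "d (nearest n y)"] by simp
  then show "\<exists>no. \<forall>n\<ge>no. norm (kdist y (d (nearest n y)) - 0) < r"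
    by blast
qed

lemma measurable_kernel_section [measurable]: "(\<lambda>x. k x y) \<in> borel_measurable borel"
  by (rule mem_measurable[OF section_mem])

text \<open>
  As the topology need not be second countable, \<open>borel \<Otimes>\<^sub>M borel\<close> may be smaller than the Borel
  algebra of the product, so that continuity of \<open>k\<close> alone is not sufficient here.
\<close>

lemma measurable_kernel: "(\<lambda>p. k (fst p) (snd p)) \<in> borel_measurable (borel \<Otimes>\<^sub>M borel)"
proof (rule borel_measurable_LIMSEQ_metric)
  fix n
  show "(\<lambda>p. k (fst p) (d (nearest n (snd p)))) \<in> borel_measurable (borel \<Otimes>\<^sub>M borel)"
    \<comment> \<open>For each fixed index only the first coordinate enters, and the index is a
      measurable function with countable range.\<close>
    by (rule measurable_compose_countable[where f = "\<lambda>i p. k (fst p) (d i)" and g = "\<lambda>p. nearest n (snd p)"])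
       measurable
next
  fix p :: "'a \<times> 'a"
  \<comment> \<open>The section at \<open>fst p\<close> is Lipschitz for \<open>kdist\<close>, so
    replacing \<open>snd p\<close> by its nearest dense point changes the value by a vanishing
    amount.\<close>
  have "(\<lambda>n. nrm (\<lambda>z. k z (fst p)) * kdist (snd p) (d (nearest n (snd p)))) \<longlonglongrightarrow> 0"
    using tendsto_mult_right_zero[OF kdist_nearest_tendsto] by blast
  then have "(\<lambda>n. k (snd p) (fst p) - k (d (nearest n (snd p))) (fst p)) \<longlonglongrightarrow> 0"
    by (rule Lim_null_comparison[rotated]) (use mem_dist_le[OF section_mem] in auto)
  then have "(\<lambda>n. k (snd p) (fst p) - (k (snd p) (fst p) - k (d (nearest n (snd p))) (fst p)))
      \<longlonglongrightarrow> k (snd p) (fst p) - 0"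
    by (intro tendsto_intros)
  then show "(\<lambda>n. k (fst p) (d (nearest n (snd p)))) \<longlonglongrightarrow> k (fst p) (snd p)"
    by (simp add: kernel_sym[of "fst p"])
qed

section \<open>Bochner integrals of kernel sections and mean embeddings\<close>

text \<open>Up to sign, \<open>ip (s n y) f - f y\<close> is the pairing of \<open>f\<close> with
  the approximation error at \<open>y\<close>, so Cauchy-Schwarz applies under the integral. The
  rate \<open>e\<close> does not depend on \<open>f\<close>, so the bound may be tested on functions
  that vary with \<open>n\<close>.\<close>

lemma simple_function_integral_approx:
  assumes Q: "finite_measure Q" "sets Q = sets borel"
    and s: "\<And>n. simple_function Q (s n)" "\<And>n. s n ` space Q \<subseteq> H"
    and meas: "\<And>n. (\<lambda>y. nrm (\<lambda>x. k x y - s n y x)) \<in> borel_measurable Q"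
    and lim: "(\<lambda>n. \<integral>\<^sup>+ y. ennreal (nrm (\<lambda>x. k x y - s n y x)) \<partial>Q) \<longlonglongrightarrow> 0"
  obtains e :: "nat \<Rightarrow> real" where "e \<longlonglongrightarrow> 0"
    and "\<forall>\<^sub>F n in sequentially. \<forall>f\<in>H.
      \<bar>ip (simple_function_integral Q (s n)) f - integral\<^sup>L Q f\<bar> \<le> nrm f * e n"
proof
  \<comment> \<open>As \<open>enn2real\<close> sends an infinite integral to \<open>0\<close>, the
    bound is claimed only from the index on where the integrals are finite.\<close>
  define e where "e n = enn2real (\<integral>\<^sup>+ y. ennreal (nrm (\<lambda>x. k x y - s n y x)) \<partial>Q)" for n
  show "e \<longlonglongrightarrow> 0"
    unfolding e_def using tendsto_enn2real[where l = 0] lim by simp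
  have "\<forall>\<^sub>F n in sequentially. (\<integral>\<^sup>+ y. ennreal (nrm (\<lambda>x. k x y - s n y x)) \<partial>Q) < top"
    using order_tendstoD(2)[OF lim] by simp
  then show "\<forall>\<^sub>F n in sequentially. \<forall>f\<in>H.
      \<bar>ip (simple_function_integral Q (s n)) f - integral\<^sup>L Q f\<bar> \<le> nrm f * e n"
  proof eventually_elim
    fix n
    assume fin: "(\<integral>\<^sup>+ y. ennreal (nrm (\<lambda>x. k x y - s n y x)) \<partial>Q) < top"
    show "\<forall>f\<in>H. \<bar>ip (simple_function_integral Q (s n)) f - integral\<^sup>L Q f\<bar> \<le> nrm f * e n"
    proof
      fix f
      assume f: "f \<in> H"
      note int = simple_function_integral_inner[OF Q(1) s[of n] f] mem_integrable[OF f Q]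
      have "ennreal \<bar>ip (simple_function_integral Q (s n)) f - integral\<^sup>L Q f\<bar>
          = ennreal (norm (\<integral>y. ip (s n y) f - f y \<partial>Q))"
        using int by simp
      also have "\<dots> \<le> (\<integral>\<^sup>+ y. ennreal (norm (ip (s n y) f - f y)) \<partial>Q)"
        using int by (intro integral_norm_bound_ennreal Bochner_Integration.integrable_diff)
      also have "\<dots> \<le> (\<integral>\<^sup>+ y. ennreal (nrm f) * ennreal (nrm (\<lambda>x. k x y - s n y x)) \<partial>Q)"
      proof (intro nn_integral_mono)
        fix y
        assume "y \<in> space Q"
        then have sy: "s n y \<in> H"
          using s by auto
        have "\<bar>ip (s n y) f - f y\<bar> = \<bar>ip f (\<lambda>x. k x y - s n y x)\<bar>"
          using f sy by (simp add: ip_diff_right section_mem ip_commute[OF f sy] flip: reproducing)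
        also have "\<dots> \<le> nrm f * nrm (\<lambda>x. k x y - s n y x)"
          using f sy by (intro Cauchy_Schwarz diff_mem section_mem)
        finally show "ennreal (norm (ip (s n y) f - f y))
            \<le> ennreal (nrm f) * ennreal (nrm (\<lambda>x. k x y - s n y x))"
          using f sy by (simp add: ennreal_mult[symmetric] nrm_nonneg diff_mem section_mem)
      qed
      also have "\<dots> = ennreal (nrm f) * ennreal (e n)"
        using meas fin by (simp add: nn_integral_cmult e_def)
      also have "\<dots> = ennreal (nrm f * e n)"
        using f by (simp add: ennreal_mult nrm_nonneg e_def)
      finally show "\<bar>ip (simple_function_integral Q (s n)) f - integral\<^sup>L Q f\<bar> \<le> nrm f * e n"
        using f by (subst (asm) ennreal_le_iff) (auto simp: nrm_nonneg e_def)
    qed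
  qed
qed

text \<open>Bochner integration commutes with pairing: the pairings of the simple integrals with
  \<open>f\<close> converge to both sides.\<close>

lemma has_bochner_integral_in_inner:
  assumes Q: "finite_measure Q" "sets Q = sets borel"
    and h: "has_bochner_integral_in H ip Q (\<lambda>y x. k x y) h" and f: "f \<in> H"
  shows "ip h f = integral\<^sup>L Q f"
proof -
  obtain s where hH: "h \<in> H"
    and s: "\<And>n. simple_function Q (s n)" "\<And>n. s n ` space Q \<subseteq> H"
      "\<And>n. (\<lambda>y. nrm (\<lambda>x. k x y - s n y x)) \<in> borel_measurable Q"
      "(\<lambda>n. \<integral>\<^sup>+ y. ennreal (nrm (\<lambda>x. k x y - s n y x)) \<partial>Q) \<longlonglongrightarrow> 0"
    and lim: "(\<lambda>n. nrm (\<lambda>x. simple_function_integral Q (s n) x - h x)) \<longlonglongrightarrow> 0"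
    using h unfolding has_bochner_integral_in_def by blast
  obtain e :: "nat \<Rightarrow> real" where e: "e \<longlonglongrightarrow> 0"
    "\<forall>\<^sub>F n in sequentially. \<forall>f\<in>H.
      \<bar>ip (simple_function_integral Q (s n)) f - integral\<^sup>L Q f\<bar> \<le> nrm f * e n"
    by (rule simple_function_integral_approx[OF Q s])
  have mem: "simple_function_integral Q (s n) \<in> H" for n
    using s(2) by (rule simple_function_integral_mem)
  have "(\<lambda>n. ip (simple_function_integral Q (s n)) f - integral\<^sup>L Q f) \<longlonglongrightarrow> 0"
  proof (rule Lim_null_comparison)
    show "\<forall>\<^sub>F n in sequentially.
        norm (ip (simple_function_integral Q (s n)) f - integral\<^sup>L Q f) \<le> nrm f * e n"
      using e(2) by eventually_elim (use f in auto)
    show "(\<lambda>n. nrm f * e n) \<longlonglongrightarrow> 0"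
      using e(1) by (rule tendsto_mult_right_zero)
  qed
  moreover have "(\<lambda>n. ip (simple_function_integral Q (s n)) f - ip h f) \<longlonglongrightarrow> 0"
  proof (rule Lim_null_comparison)
    show "\<forall>\<^sub>F n in sequentially. norm (ip (simple_function_integral Q (s n)) f - ip h f)
        \<le> nrm (\<lambda>x. simple_function_integral Q (s n) x - h x) * nrm f"
      using Cauchy_Schwarz[OF diff_mem[OF mem hH] f] ip_diff_left[OF mem hH f] by auto
    show "(\<lambda>n. nrm (\<lambda>x. simple_function_integral Q (s n) x - h x) * nrm f) \<longlonglongrightarrow> 0"
      using lim by (rule tendsto_mult_left_zero)
  qed
  ultimately show ?thesis
    unfolding LIM_zero_iff by (rule LIMSEQ_unique[rotated])
qed

text \<open>The section at \<open>y\<close> is approximated by the section at the nearest dense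
  point. The error is a \<open>kdist\<close>, bounded by \<open>kdist_le\<close>, so dominated
  convergence applies; completeness then provides the limit of the simple integrals.\<close>

lemma has_bochner_integral_in_exists:
  assumes Q: "finite_measure Q" "sets Q = sets borel"
  shows "\<exists>h. has_bochner_integral_in H ip Q (\<lambda>y x. k x y) h"
proof -
  interpret finite_measure Q by fact
  define s where "s n y = (\<lambda>x. k x (d (nearest n y)))" for n y
  have [measurable_cong]: "sets Q = sets borel" by fact
  have nrm_s: "nrm (\<lambda>x. k x y - s n y x) = kdist y (d (nearest n y))" for n y
    by (simp add: s_def kdist_def)
  have s1: "simple_function Q (s n)" for n
  proof -
    have "finite (nearest n ` space Q)"
      by (rule finite_subset[of _ "{..n}"]) (auto simp: nearest_le)
    moreover have "nearest n \<in> measurable Q (count_space UNIV)"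
      by measurable
    ultimately have "simple_function Q (nearest n)"
      by (simp add: simple_function_eq_measurable)
    then show ?thesis
      unfolding s_def by (rule simple_function_compose1)
  qed
  have s2: "s n ` space Q \<subseteq> H" for n
    by (auto simp: s_def section_mem)
  have meas: "(\<lambda>y. kdist y (d (nearest n y))) \<in> borel_measurable Q" for n
    by (rule measurable_compose_countable[where f = "\<lambda>i y. kdist y (d i)" and g = "nearest n"]) measurable
  have lim: "(\<lambda>n. \<integral>\<^sup>+ y. ennreal (kdist y (d (nearest n y))) \<partial>Q) \<longlonglongrightarrow> (\<integral>\<^sup>+ y. 0 \<partial>Q)"
  proof (rule nn_integral_dominated_convergence)
    show "(\<integral>\<^sup>+ y. ennreal (sqrt (4 * C)) \<partial>Q) < \<infinity>"
      by (simp add: less_top[symmetric] ennreal_mult_eq_top_iff)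
    show "AE y in Q. (\<lambda>n. ennreal (kdist y (d (nearest n y)))) \<longlonglongrightarrow> 0"
      using tendsto_ennrealI[OF kdist_nearest_tendsto] by simp
  qed (use meas kdist_le in \<open>auto intro!: ennreal_leI\<close>)
  have meas': "(\<lambda>y. nrm (\<lambda>x. k x y - s n y x)) \<in> borel_measurable Q" for n
    unfolding nrm_s by (rule meas)
  have lim': "(\<lambda>n. \<integral>\<^sup>+ y. ennreal (nrm (\<lambda>x. k x y - s n y x)) \<partial>Q) \<longlonglongrightarrow> 0"
    unfolding nrm_s using lim by simp
  obtain e :: "nat \<Rightarrow> real" where e: "e \<longlonglongrightarrow> 0"
    "\<forall>\<^sub>F n in sequentially. \<forall>f\<in>H.
      \<bar>ip (simple_function_integral Q (s n)) f - integral\<^sup>L Q f\<bar> \<le> nrm f * e n"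
    by (rule simple_function_integral_approx[OF Q s1 s2 meas' lim'])
  define I where "I n = simple_function_integral Q (s n)" for n
  have mem: "I n \<in> H" for n
    unfolding I_def using s2 by (rule simple_function_integral_mem)
  obtain h where "h \<in> H" "(\<lambda>n. nrm (\<lambda>x. I n x - h x)) \<longlonglongrightarrow> 0"
  proof (rule complete[of I])
    fix r :: real
    assume "0 < r"
    then have "\<forall>\<^sub>F n in sequentially. e n < r / 2"
      using order_tendstoD(2)[OF e(1), of "r / 2"] by simp
    with e(2) have "\<forall>\<^sub>F n in sequentially. e n < r / 2 \<and>
        (\<forall>f\<in>H. \<bar>ip (I n) f - integral\<^sup>L Q f\<bar> \<le> nrm f * e n)"
      unfolding I_def by eventually_elim auto
    then obtain N where N: "\<And>n. N \<le> n \<Longrightarrow> e n < r / 2"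
      "\<And>n f. N \<le> n \<Longrightarrow> f \<in> H \<Longrightarrow> \<bar>ip (I n) f - integral\<^sup>L Q f\<bar> \<le> nrm f * e n"
      unfolding eventually_sequentially by blast
    have "nrm (\<lambda>x. I m x - I n x) < r" if "N \<le> m" "N \<le> n" for m n
    proof -
      \<comment> \<open>The uniform bound is tested on the difference itself:
        \<open>nrm w * nrm w\<close> is at most \<open>nrm w * (e m + e n)\<close>, and a nonzero
        factor cancels.\<close>
      define w where "w = (\<lambda>x. I m x - I n x)"
      have w: "w \<in> H"
        unfolding w_def by (intro diff_mem mem)
      have "nrm w * nrm w = ip w w"
        using nrm_square[OF w] by (simp add: power2_eq_square)
      also have "\<dots> = ip (I m) w - ip (I n) w"
        using w by (subst (1) w_def) (simp add: ip_diff_left mem)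
      also have "\<dots> \<le> nrm w * (e m + e n)"
        using N(2)[OF that(1) w] N(2)[OF that(2) w] by (simp add: algebra_simps)
      finally have "nrm w = 0 \<or> nrm w \<le> e m + e n"
        using nrm_nonneg[OF w] by (auto simp: mult_le_cancel_left)
      then show ?thesis
        using N(1)[OF that(1)] N(1)[OF that(2)] \<open>0 < r\<close> by (auto simp: w_def)
    qed
    then show "\<exists>N. \<forall>m\<ge>N. \<forall>n\<ge>N. nrm (\<lambda>x. I m x - I n x) < r"
      by blast
  qed (use mem in auto)
  then have "has_bochner_integral_in H ip Q (\<lambda>y x. k x y) h"
    unfolding has_bochner_integral_in_def
    using s1 s2 meas' lim' section_mem by (auto simp: I_def intro!: exI[of _ s])
  then show ?thesis
    by blast
qed

text \<open>The description \<open>THE\<close> is meaningful: an integral exists, and testing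
  against sections determines its value at every point.\<close>

lemma kernel_mean_embedding_mem:
    "finite_measure Q \<Longrightarrow> sets Q = sets borel \<Longrightarrow> kernel_mean_embedding H ip k Q \<in> H"
  and kernel_mean_embedding_inner:
    "finite_measure Q \<Longrightarrow> sets Q = sets borel \<Longrightarrow> f \<in> H \<Longrightarrow>
      ip (kernel_mean_embedding H ip k Q) f = integral\<^sup>L Q f"
proof -
  have "has_bochner_integral_in H ip Q (\<lambda>y x. k x y) (kernel_mean_embedding H ip k Q)"
    if Q: "finite_measure Q" "sets Q = sets borel"
  proof -
    have "h x = (\<integral>y. k y x \<partial>Q)" if "has_bochner_integral_in H ip Q (\<lambda>y x. k x y) h" for h x
      using has_bochner_integral_in_inner[OF Q that section_mem] reproducing[of h x] that
      by (simp add: has_bochner_integral_in_def)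
    then have "\<exists>!h. has_bochner_integral_in H ip Q (\<lambda>y x. k x y) h"
      using has_bochner_integral_in_exists[OF Q] by (metis ext)
    then show ?thesis
      unfolding kernel_mean_embedding_def by (rule theI')
  qed
  then show "finite_measure Q \<Longrightarrow> sets Q = sets borel \<Longrightarrow> kernel_mean_embedding H ip k Q \<in> H"
    and "finite_measure Q \<Longrightarrow> sets Q = sets borel \<Longrightarrow> f \<in> H \<Longrightarrow>
      ip (kernel_mean_embedding H ip k Q) f = integral\<^sup>L Q f"
    using has_bochner_integral_in_inner by (auto simp: has_bochner_integral_in_def)
qed

lemma kernel_mean_embedding_eq:
  "finite_measure Q \<Longrightarrow> sets Q = sets borel \<Longrightarrow> kernel_mean_embedding H ip k Q x = (\<integral>y. k y x \<partial>Q)"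
  by (subst reproducing) (simp_all add: kernel_mean_embedding_mem kernel_mean_embedding_inner section_mem)

end

section \<open>Empirical measures as laws of a uniformly chosen sample point\<close>

text \<open>In this form integrals become finite averages. The condition on \<open>n\<close> makes
  the index set nonempty, so that its uniform law exists.\<close>

lemma empirical_measure_eq_distr:
  assumes "1 \<le> n"
  shows "empirical_measure x n = distr (measure_pmf (pmf_of_set {1..n})) borel x"
proof (rule measure_eqI)
  fix A :: "'a set"
  assume "A \<in> sets (empirical_measure x n)"
  then have A: "A \<in> sets borel"
    by simp
  have "emeasure (distr (measure_pmf (pmf_of_set {1..n})) borel x) A
      = ennreal (real (card ({1..n} \<inter> x -` A)) / real n)"
    using A assms by (subst emeasure_distr) (auto simp: emeasure_pmf_of_set)
  also have "\<dots> = of_nat (card ({1..n} \<inter> x -` A)) / of_nat n"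
    using assms by (simp add: divide_ennreal[symmetric] ennreal_of_nat_eq_real_of_nat)
  also have "\<dots> = (\<Sum>i=1..n. emeasure (return borel (x i)) A) / of_nat n"
    using A by (simp add: indicator_def sum.If_cases Int_def vimage_def conj_commute)
  finally show "emeasure (empirical_measure x n) A
      = emeasure (distr (measure_pmf (pmf_of_set {1..n})) borel x) A"
    by (simp add: emeasure_empirical_measure[OF A])
qed simp

lemma prob_space_empirical_measure:
  assumes "1 \<le> n"
  shows "prob_space (empirical_measure x n)"
  unfolding empirical_measure_eq_distr[OF assms]
  by (rule prob_space.prob_space_distr) (auto intro: prob_space_measure_pmf)

lemma integral_empirical_measure:
  fixes f :: "'a::topological_space \<Rightarrow> real"
  assumes "1 \<le> n" and [measurable]: "f \<in> borel_measurable borel"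
  shows "integral\<^sup>L (empirical_measure x n) f = (\<Sum>i=1..n. f (x i)) / n"
  unfolding empirical_measure_eq_distr[OF assms(1)]
  using assms by (simp add: integral_distr integral_pmf_of_set)

section \<open>Concentration of degenerate quadratic forms\<close>

lemma is_kernel_sum_nonneg:
  assumes "is_kernel g"
  shows "0 \<le> (\<Sum>i=1..n::nat. \<Sum>j=1..n. g (x i) (x j))"
proof -
  have "0 \<le> (\<Sum>i=1..n. \<Sum>j=1..n. 1 * 1 * g (x i) (x j))"
    using assms unfolding is_kernel_def by (elim conjE) (drule spec[of _ n], drule spec[of _ "\<lambda>_. 1"], blast)
  then show ?thesis
    by simp
qed

text \<open>With weight \<open>1\<close> on each \<open>x i\<close> and weight \<open>t\<close> on
  \<open>y\<close>, positive definiteness gives a polynomial of degree at most two in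
  \<open>t\<close> that is nonnegative; its discriminant yields the claim.\<close>

lemma is_kernel_Cauchy_Schwarz:
  assumes "is_kernel g"
  shows "(\<Sum>i=1..n::nat. g (x i) y)\<^sup>2 \<le> (\<Sum>i=1..n. \<Sum>j=1..n. g (x i) (x j)) * g y y"
proof -
  define c where "c = (\<Sum>i=1..n. g (x i) y)"
  define q where "q = (\<Sum>i=1..n. \<Sum>j=1..n. g (x i) (x j))"
  have psd: "0 \<le> q + 2 * t * c + t\<^sup>2 * g y y" for t
  proof -
    define a where "a i = (if i \<le> n then 1 else t)" for i
    define x' where "x' i = (if i \<le> n then x i else y)" for i
    have "0 \<le> (\<Sum>i=1..Suc n. \<Sum>j=1..Suc n. a i * a j * g (x' i) (x' j))"
      using assms unfolding is_kernel_def by blast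
    also have "\<dots> = (\<Sum>i=1..n. \<Sum>j=1..n. a i * a j * g (x' i) (x' j))
        + (\<Sum>i=1..n. a i * a (Suc n) * g (x' i) (x' (Suc n)))
        + (\<Sum>j=1..n. a (Suc n) * a j * g (x' (Suc n)) (x' j))
        + a (Suc n) * a (Suc n) * g (x' (Suc n)) (x' (Suc n))"
      by (simp add: sum.distrib)
    also have "(\<Sum>i=1..n. \<Sum>j=1..n. a i * a j * g (x' i) (x' j)) = q"
      unfolding q_def by (intro sum.cong) (auto simp: a_def x'_def)
    also have "(\<Sum>i=1..n. a i * a (Suc n) * g (x' i) (x' (Suc n))) = t * c"
      unfolding c_def sum_distrib_left by (intro sum.cong) (auto simp: a_def x'_def)
    also have "(\<Sum>j=1..n. a (Suc n) * a j * g (x' (Suc n)) (x' j)) = t * c"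
      unfolding c_def sum_distrib_left
      using assms by (intro sum.cong) (auto simp: a_def x'_def is_kernel_def)
    also have "a (Suc n) * a (Suc n) * g (x' (Suc n)) (x' (Suc n)) = t\<^sup>2 * g y y"
      by (simp add: a_def x'_def power2_eq_square)
    finally show ?thesis
      by (simp add: algebra_simps)
  qed
  have "c\<^sup>2 \<le> q * g y y"
  proof (cases "g y y = 0")
    case True
    have "c = 0"
    proof (rule ccontr)
      assume "c \<noteq> 0"
      then show False
        \<comment> \<open>Without a quadratic term, this \<open>t\<close> gives the value
          \<open>q - (q + 1) = - 1\<close>.\<close>
        using psd[of "- (q + 1) / (2 * c)"] True by (simp add: field_simps)
    qed
    then show ?thesis
      using True by simp
  next
    case False
    have "0 \<le> g y y"
      using is_kernel_sum_nonneg[OF assms, of "\<lambda>_. y" 1] by simp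
    with False show ?thesis
      \<comment> \<open>The vertex of the parabola.\<close>
      using psd[of "- c / g y y"] by (simp add: field_simps power2_eq_square)
  qed
  then show ?thesis
    by (simp add: c_def q_def)
qed

text \<open>Independence makes the joint law a product, and Fubini integrates over \<open>Z\<close>
  first with \<open>Y\<close> frozen. This takes the place of conditioning on the past.\<close>

lemma (in prob_space) indep_var_integral_eq_0:
  fixes K :: "'s \<times> 's \<Rightarrow> real"
  assumes ind: "indep_var S Y T Z" and K [measurable]: "K \<in> borel_measurable (S \<Otimes>\<^sub>M T)"
    and bound: "\<And>p. p \<in> space (S \<Otimes>\<^sub>M T) \<Longrightarrow> \<bar>K p\<bar> \<le> b"
    and zero: "\<And>y. y \<in> space S \<Longrightarrow> (\<integral>z. K (y, z) \<partial>distr M T Z) = 0"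
  shows "integrable M (\<lambda>\<omega>. K (Y \<omega>, Z \<omega>))" and "expectation (\<lambda>\<omega>. K (Y \<omega>, Z \<omega>)) = 0"
proof -
  have [measurable]: "Y \<in> measurable M S" "Z \<in> measurable M T"
    and dist: "distr M S Y \<Otimes>\<^sub>M distr M T Z = distr M (S \<Otimes>\<^sub>M T) (\<lambda>\<omega>. (Y \<omega>, Z \<omega>))"
    using ind by (auto simp: indep_var_distribution_eq)
  interpret DY: prob_space "distr M S Y"
    by (rule prob_space_distr) measurable
  interpret DZ: prob_space "distr M T Z"
    by (rule prob_space_distr) measurable
  interpret D: pair_prob_space "distr M S Y" "distr M T Z" ..
  have int: "integrable (distr M S Y \<Otimes>\<^sub>M distr M T Z) K"
  proof (rule D.integrable_const_bound)
    show "AE p in distr M S Y \<Otimes>\<^sub>M distr M T Z. norm (K p) \<le> b"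
      using bound by (intro AE_I2) (auto simp: space_pair_measure)
  qed measurable
  then show "integrable M (\<lambda>\<omega>. K (Y \<omega>, Z \<omega>))"
    unfolding dist by (subst (asm) integrable_distr_eq) auto
  have "expectation (\<lambda>\<omega>. K (Y \<omega>, Z \<omega>)) = integral\<^sup>L (distr M S Y \<Otimes>\<^sub>M distr M T Z) K"
    unfolding dist by (subst integral_distr) auto
  also have "\<dots> = (\<integral>y. (\<integral>z. K (y, z) \<partial>distr M T Z) \<partial>distr M S Y)"
    using D.integral_fst'[OF int] by simp
  also have "\<dots> = (\<integral>y. 0 \<partial>distr M S Y)"
    using zero by (intro Bochner_Integration.integral_cong) auto
  finally show "expectation (\<lambda>\<omega>. K (Y \<omega>, Z \<omega>)) = 0"
    by simp
qed

text \<open>Bounds the linear term of \<open>cosh_sqrt_add_le\<close>, which is needed for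
  integrability. If \<open>a * B = 0\<close>, both sides vanish, because \<open>c = 0\<close> and
  \<open>sinh 0 = 0\<close>.\<close>

lemma abs_mult_sinh_div_le:
  fixes a c B :: real
  assumes "0 \<le> a" "0 \<le> B" "\<bar>c\<bar> \<le> a * B"
  shows "\<bar>c * (sinh a / a * (sinh B / B))\<bar> \<le> sinh a * sinh B"
proof -
  have "\<bar>c * (sinh a / a * (sinh B / B))\<bar> = \<bar>c\<bar> * (sinh a / a * (sinh B / B))"
    using assms by (simp add: abs_mult)
  also have "\<dots> \<le> (a * B) * (sinh a / a * (sinh B / B))"
    using assms by (intro mult_right_mono) auto
  also have "\<dots> \<le> sinh a * sinh B"
    using assms by auto
  finally show ?thesis .
qed

text \<open>Here \<open>g x y\<close> stands for the inner product of \<open>\<psi> x\<close> and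
  \<open>\<psi> y\<close>. Working with these real Gram entries avoids random variables with values
  in \<open>H\<close>; \<open>degenerate\<close> expresses mean zero and \<open>diag_le\<close> the
  norm bound.\<close>

locale iid_degenerate_kernel = prob_space M
  for M :: "'w measure" +
  fixes N P :: "'b measure" and X :: "nat \<Rightarrow> 'w \<Rightarrow> 'b" and g :: "'b \<Rightarrow> 'b \<Rightarrow> real" and B :: real
  assumes indep: "indep_vars (\<lambda>_. N) X {1..}"
    and distr_X: "1 \<le> i \<Longrightarrow> distr M N (X i) = P"
    and kernel: "is_kernel g"
    and measurable_g: "(\<lambda>p. g (fst p) (snd p)) \<in> borel_measurable (N \<Otimes>\<^sub>M N)"
    and diag_le: "g x x \<le> B\<^sup>2"
    and B_pos: "0 < B"
    and degenerate: "(\<integral>y. g x y \<partial>P) = 0"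
begin

text \<open>In Gram entries, this is the square of
  \<open>\<parallel>S\<^sub>n\<parallel>\<close>.\<close>

definition quad :: "nat \<Rightarrow> (nat \<Rightarrow> 'b) \<Rightarrow> real" where
  "quad n x = (\<Sum>i=1..n. \<Sum>j=1..n. g (x i) (x j))"

lemma quad_nonneg: "0 \<le> quad n x"
  unfolding quad_def by (rule is_kernel_sum_nonneg[OF kernel])

text \<open>Cauchy-Schwarz for the partial sum and one further vector of norm at most
  \<open>B\<close>; it supplies the condition on \<open>c\<close> in
  \<open>cosh_sqrt_add_le\<close>.\<close>

lemma cross_le: "\<bar>\<Sum>i=1..n. g (x i) y\<bar> \<le> sqrt (quad n x) * B"
proof -
  have "(\<Sum>i=1..n. g (x i) y)\<^sup>2 \<le> quad n x * B\<^sup>2"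
    unfolding quad_def using is_kernel_Cauchy_Schwarz[OF kernel, of x y n] quad_nonneg[of n x] diag_le[of y]
    by (auto simp: quad_def intro: order_trans mult_left_mono)
  then have "sqrt ((\<Sum>i=1..n. g (x i) y)\<^sup>2) \<le> sqrt (quad n x * B\<^sup>2)"
    by (rule real_sqrt_le_mono)
  then show ?thesis
    using B_pos by (simp add: real_sqrt_mult)
qed

lemma quad_Suc: "quad (Suc n) x = quad n x + 2 * (\<Sum>i=1..n. g (x i) (x (Suc n))) + g (x (Suc n)) (x (Suc n))"
proof -
  have "(\<Sum>i=1..n. g (x (Suc n)) (x i)) = (\<Sum>i=1..n. g (x i) (x (Suc n)))"
    using kernel by (intro sum.cong) (auto simp: is_kernel_def)
  then show ?thesis
    by (simp add: quad_def sum.distrib)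
qed

text \<open>The triangle inequality, one summand at a time; this crude bound serves
  integrability.\<close>

lemma sqrt_quad_le: "sqrt (quad n x) \<le> n * B"
proof (induction n)
  case 0
  then show ?case
    by (simp add: quad_def)
next
  case (Suc n)
  have "quad (Suc n) x \<le> (sqrt (quad n x))\<^sup>2 + 2 * (sqrt (quad n x) * B) + B\<^sup>2"
    using cross_le[of x "x (Suc n)" n] diag_le[of "x (Suc n)"] quad_nonneg[of n x] by (simp add: quad_Suc)
  also have "\<dots> = (sqrt (quad n x) + B)\<^sup>2"
    by (simp add: power2_sum)
  finally have "sqrt (quad (Suc n) x) \<le> sqrt (quad n x) + B"
    using B_pos quad_nonneg[of n x] by (intro real_le_lsqrt) auto
  then show ?case
    using Suc by (simp add: algebra_simps)
qed

lemma measurable_X [measurable]: "1 \<le> i \<Longrightarrow> X i \<in> measurable M N"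
  using indep by (auto simp: indep_vars_def)

text \<open>The space \<open>M'\<close> is free because the form also occurs on the product space of
  the past and the next observation.\<close>

lemma measurable_quad [measurable]:
  assumes "\<And>i. 1 \<le> i \<Longrightarrow> i \<le> n \<Longrightarrow> (\<lambda>\<omega>. Y \<omega> i) \<in> measurable M' N"
  shows "(\<lambda>\<omega>. quad n (Y \<omega>)) \<in> borel_measurable M'"
  unfolding quad_def
  using measurable_compose[OF measurable_Pair[OF assms assms] measurable_g]
  by (intro borel_measurable_sum) auto

lemma measurable_cosh [measurable]: "(cosh :: real \<Rightarrow> real) \<in> borel_measurable borel"
  and measurable_sinh [measurable]: "(sinh :: real \<Rightarrow> real) \<in> borel_measurable borel"
  by (intro borel_measurable_continuous_onI continuous_intros)+

lemma integrable_cosh_quad: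
  assumes "0 \<le> l"
  shows "integrable M (\<lambda>\<omega>. cosh (l * sqrt (quad n (\<lambda>i. X i \<omega>))))"
proof (rule integrable_const_bound)
  have "l * sqrt (quad n x) \<le> l * (n * B)" for x
    using assms sqrt_quad_le by (intro mult_left_mono) auto
  then show "AE \<omega> in M. norm (cosh (l * sqrt (quad n (\<lambda>i. X i \<omega>)))) \<le> cosh (l * (n * B))"
    using assms quad_nonneg B_pos by (intro AE_I2) (auto simp: cosh_real_nonneg_le_iff)
  have [measurable]: "(\<lambda>\<omega>. quad n (\<lambda>i. X i \<omega>)) \<in> borel_measurable M"
    by (rule measurable_quad) measurable
  show "(\<lambda>\<omega>. cosh (l * sqrt (quad n (\<lambda>i. X i \<omega>)))) \<in> borel_measurable M"
    by measurable
qed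

text \<open>
  The increment is bounded pointwise by a term linear in the cross sum
  \<open>\<Sum>i\<le>n. g (X i) (X (n + 1))\<close>, whose expectation vanishes because \<open>X (n + 1)\<close> is
  independent of the past and \<open>g\<close> is degenerate.
\<close>

lemma expectation_cosh_quad_le:
  assumes l: "0 \<le> l"
  shows "expectation (\<lambda>\<omega>. cosh (l * sqrt (quad n (\<lambda>i. X i \<omega>)))) \<le> cosh (l * B) ^ n"
proof (induction n)
  case 0
  then show ?case
    by (simp add: quad_def prob_space)
next
  case (Suc n)
  \<comment> \<open>The linear term of \<open>cosh_sqrt_add_le\<close> as a function of the past and
    the next observation. Scaling all vectors by \<open>l\<close> brings in the factor
    \<open>l\<^sup>2\<close>.\<close>
  define K where "K p = l\<^sup>2 * (\<Sum>i=1..n. g (fst p i) (snd p (Suc n))) *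
    (sinh (l * sqrt (quad n (fst p))) / (l * sqrt (quad n (fst p))) * (sinh (l * B) / (l * B)))"
    for p :: "(nat \<Rightarrow> 'b) \<times> (nat \<Rightarrow> 'b)"
  define S where "S = PiM {1..n} (\<lambda>_. N)"
  define T where "T = PiM {Suc n} (\<lambda>_. N)"
  \<comment> \<open>Independence of disjoint index blocks concerns families, hence even the single
    next observation is kept as a family over \<open>{Suc n}\<close>.\<close>
  define Y where "Y \<omega> = restrict (\<lambda>i. X i \<omega>) {1..n}" for \<omega>
  define Z where "Z \<omega> = restrict (\<lambda>i. X i \<omega>) {Suc n}" for \<omega>
  have cross: "\<bar>l\<^sup>2 * (\<Sum>i=1..n. g (x i) y)\<bar> \<le> (l * sqrt (quad n x)) * (l * B)" for x y
    using mult_left_mono[OF cross_le[of x y n], of "l\<^sup>2"]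
    by (simp add: abs_mult power2_eq_square mult_ac)
  have step: "cosh (l * sqrt (quad (Suc n) x)) \<le>
      cosh (l * sqrt (quad n x)) * cosh (l * B) + K (restrict x {1..n}, restrict x {Suc n})" for x
  proof -
    let ?a = "l * sqrt (quad n x)" and ?c = "l\<^sup>2 * (\<Sum>i=1..n. g (x i) (x (Suc n)))"
      and ?b = "l\<^sup>2 * g (x (Suc n)) (x (Suc n))"
    have eq: "?a\<^sup>2 + 2 * ?c + ?b = l\<^sup>2 * quad (Suc n) x"
      using quad_nonneg[of n x] by (simp add: quad_Suc power_mult_distrib algebra_simps)
    have "cosh (sqrt (?a\<^sup>2 + 2 * ?c + ?b))
        \<le> cosh ?a * cosh (l * B) + ?c * (sinh ?a / ?a * (sinh (l * B) / (l * B)))"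
    proof (rule cosh_sqrt_add_le)
      show "?b \<le> (l * B)\<^sup>2"
        using diag_le by (simp add: power_mult_distrib mult_left_mono)
      show "0 \<le> ?a\<^sup>2 + 2 * ?c + ?b"
        unfolding eq using quad_nonneg by simp
    qed (use cross l B_pos quad_nonneg in auto)
    moreover have "quad n (restrict x {1..n}) = quad n x"
      by (simp add: quad_def)
    ultimately show ?thesis
      using l unfolding eq by (simp add: K_def real_sqrt_mult)
  qed
  have ind: "indep_var S Y T Z"
    unfolding S_def T_def Y_def Z_def by (rule indep_var_restrict[OF indep]) auto
  have measK: "K \<in> borel_measurable (S \<Otimes>\<^sub>M T)"
  proof -
    have comp: "(\<lambda>p. fst p i) \<in> measurable (S \<Otimes>\<^sub>M T) N" if "i \<in> {1..n}" for i
      unfolding S_def using that by measurable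
    have last: "(\<lambda>p. snd p (Suc n)) \<in> measurable (S \<Otimes>\<^sub>M T) N"
      unfolding T_def by measurable
    have [measurable]: "(\<lambda>p. quad n (fst p)) \<in> borel_measurable (S \<Otimes>\<^sub>M T)"
      by (rule measurable_quad) (use comp in auto)
    have [measurable]: "(\<lambda>p. \<Sum>i=1..n. g (fst p i) (snd p (Suc n))) \<in> borel_measurable (S \<Otimes>\<^sub>M T)"
      using measurable_compose[OF measurable_Pair[OF comp last] measurable_g]
      by (intro borel_measurable_sum) auto
    show ?thesis
      unfolding K_def by measurable
  qed
  have boundK: "\<bar>K p\<bar> \<le> sinh (l * (n * B)) * sinh (l * B)" for p
  proof -
    have "l * sqrt (quad n (fst p)) \<le> l * (n * B)"
      using l sqrt_quad_le by (intro mult_left_mono) auto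
    then have "sinh (l * sqrt (quad n (fst p))) * sinh (l * B) \<le> sinh (l * (n * B)) * sinh (l * B)"
      using l B_pos by (intro mult_right_mono) auto
    moreover have "\<bar>K p\<bar> \<le> sinh (l * sqrt (quad n (fst p))) * sinh (l * B)"
      unfolding K_def by (rule abs_mult_sinh_div_le) (use l B_pos quad_nonneg cross in auto)
    ultimately show ?thesis
      by linarith
  qed
  have zeroK: "(\<integral>z. K (y, z) \<partial>distr M T Z) = 0" if y: "y \<in> space S" for y
  proof -
    interpret P: prob_space P
      using prob_space_distr[OF measurable_X[of 1]] by (simp add: distr_X)
    have P: "sets P = sets N"
      using distr_X[of 1] by (metis order_refl sets_distr)
    have meas: "g (y i) \<in> borel_measurable N" if "i \<in> {1..n}" for i
    proof -
      have "y i \<in> space N"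
        using y that unfolding S_def space_PiM by (rule PiE_mem)
      then show ?thesis
        using measurable_compose[OF measurable_Pair1' measurable_g] by simp
    qed
    have int: "integrable P (g (y i))" if i: "i \<in> {1..n}" for i
    proof -
      \<comment> \<open>The case of one summand in \<open>cross_le\<close> and
        \<open>sqrt_quad_le\<close> bounds \<open>g\<close> itself.\<close>
      have "\<bar>g (y i) z\<bar> \<le> B * B" for z
      proof -
        have "\<bar>g (y i) z\<bar> \<le> sqrt (quad 1 (\<lambda>_. y i)) * B"
          using cross_le[of "\<lambda>_. y i" z 1] by simp
        also have "\<dots> \<le> B * B"
          using sqrt_quad_le[of 1 "\<lambda>_. y i"] B_pos by (intro mult_right_mono) auto
        finally show ?thesis .
      qed
      then show ?thesis
        using meas[OF i]
        by (intro P.integrable_const_bound[of _ "B * B"]) (auto simp: measurable_cong_sets[OF P refl])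
    qed
    \<comment> \<open>With the past frozen at \<open>y\<close> the \<open>sinh\<close> quotients are
      constant, so the integral acts on the cross sum only.\<close>
    define r where "r = l\<^sup>2 * (sinh (l * sqrt (quad n y)) / (l * sqrt (quad n y)) * (sinh (l * B) / (l * B)))"
    have "Z \<in> measurable M T"
      using ind by (rule indep_var_rv2)
    then have "(\<integral>z. K (y, z) \<partial>distr M T Z) = expectation (\<lambda>\<omega>. K (y, Z \<omega>))"
      using measurable_compose[OF measurable_Pair1'[OF y] measK] by (rule integral_distr)
    also have "\<dots> = expectation (\<lambda>\<omega>. r * (\<Sum>i=1..n. g (y i) (X (Suc n) \<omega>)))"
      by (intro Bochner_Integration.integral_cong) (auto simp: K_def Z_def r_def)
    also have "\<dots> = (\<integral>z. r * (\<Sum>i=1..n. g (y i) z) \<partial>distr M N (X (Suc n)))"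
      using meas by (intro integral_distr[symmetric]) auto
    also have "\<dots> = r * (\<Sum>i=1..n. \<integral>z. g (y i) z \<partial>P)"
      using int by (simp add: distr_X Bochner_Integration.integral_sum)
    finally show ?thesis
      by (simp add: degenerate)
  qed
  note K = indep_var_integral_eq_0[OF ind measK boundK zeroK]
  have "expectation (\<lambda>\<omega>. cosh (l * sqrt (quad (Suc n) (\<lambda>i. X i \<omega>))))
      \<le> expectation (\<lambda>\<omega>. cosh (l * sqrt (quad n (\<lambda>i. X i \<omega>))) * cosh (l * B) + K (Y \<omega>, Z \<omega>))"
    using integrable_cosh_quad[OF l] K(1)
    by (intro integral_mono Bochner_Integration.integrable_add integrable_mult_left)
       (auto simp only: Y_def Z_def intro: step)
  also have "\<dots> = expectation (\<lambda>\<omega>. cosh (l * sqrt (quad n (\<lambda>i. X i \<omega>)))) * cosh (l * B)"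
    using integrable_cosh_quad[OF l] K by simp
  also have "\<dots> \<le> cosh (l * B) ^ n * cosh (l * B)"
    using Suc by (intro mult_right_mono) auto
  finally show ?case
    by (simp add: mult.commute)
qed

text \<open>Chernoff's method: as \<open>exp u \<le> 2 * cosh u\<close>, the indicator of the event
  is at most \<open>2 * exp (- (l * t))\<close> times the \<open>cosh\<close> whose expectation is
  already bounded.\<close>

lemma prob_sqrt_quad_gt_le:
  assumes n: "1 \<le> n" and t: "0 \<le> t"
  shows "prob {\<omega> \<in> space M. t < sqrt (quad n (\<lambda>i. X i \<omega>))} \<le> 2 * exp (- (t\<^sup>2 / (4 * real n * B\<^sup>2)))"
proof -
  \<comment> \<open>The minimiser of the resulting exponent
    \<open>n * (l * B)\<^sup>2 - l * t\<close>.\<close>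
  define l where "l = t / (2 * n * B\<^sup>2)"
  define A where "A = {\<omega> \<in> space M. t < sqrt (quad n (\<lambda>i. X i \<omega>))}"
  have l: "0 \<le> l"
    using t by (simp add: l_def)
  have [measurable]: "(\<lambda>\<omega>. quad n (\<lambda>i. X i \<omega>)) \<in> borel_measurable M"
    by (rule measurable_quad) measurable
  have A: "A \<in> events"
    unfolding A_def by measurable
  have "prob A = expectation (indicator A)"
    using A by simp
  also have "\<dots> \<le> expectation (\<lambda>\<omega>. 2 * exp (- (l * t)) * cosh (l * sqrt (quad n (\<lambda>i. X i \<omega>))))"
  proof (rule integral_mono)
    show "integrable M (indicator A :: _ \<Rightarrow> real)"
      using A by (intro integrable_real_indicator) (auto simp: less_top[symmetric])
    show "integrable M (\<lambda>\<omega>. 2 * exp (- (l * t)) * cosh (l * sqrt (quad n (\<lambda>i. X i \<omega>))))"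
      using integrable_cosh_quad[OF l] by simp
    fix \<omega>
    let ?q = "sqrt (quad n (\<lambda>i. X i \<omega>))"
    show "indicator A \<omega> \<le> 2 * exp (- (l * t)) * cosh (l * ?q)"
    proof (cases "\<omega> \<in> A")
      case True
      then have "exp (l * t) \<le> exp (l * ?q)"
        using l by (simp add: A_def mult_left_mono)
      also have "\<dots> \<le> 2 * cosh (l * ?q)"
        by (simp add: cosh_field_def)
      finally show ?thesis
        using True by (simp add: exp_minus field_simps)
    qed auto
  qed
  also have "\<dots> \<le> 2 * exp (- (l * t)) * cosh (l * B) ^ n"
    using expectation_cosh_quad_le[OF l, of n] by simp
  also have "\<dots> \<le> 2 * exp (- (l * t)) * exp ((l * B)\<^sup>2) ^ n"
    by (intro mult_left_mono power_mono cosh_le_exp_square) auto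
  also have "\<dots> = 2 * exp (n * (l * B)\<^sup>2 - l * t)"
    by (simp add: exp_of_nat_mult[symmetric] exp_diff exp_minus divide_inverse mult.commute)
  also have "n * (l * B)\<^sup>2 - l * t = - (t\<^sup>2 / (4 * real n * B\<^sup>2))"
    using n B_pos by (simp add: l_def field_simps power2_eq_square)
  finally show ?thesis
    by (simp add: A_def)
qed

end

section \<open>Uniform convergence of empirical mean embeddings\<close>

text \<open>A value above the supremum over the sequence would give a nonempty open set that the
  sequence avoids. The countable supremum is what makes the error measurable.\<close>

lemma SUP_dense_sequence:
  fixes f :: "'a::topological_space \<Rightarrow> real"
  assumes f: "continuous_on UNIV f" and bdd: "bdd_above (range f)"
    and dense: "\<And>x S. open S \<Longrightarrow> x \<in> S \<Longrightarrow> \<exists>n. d n \<in> S"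
  shows "(SUP x. f x) = (SUP n::nat. f (d n))"
proof (rule antisym)
  have bdd': "bdd_above (range (\<lambda>n. f (d n)))"
    using bdd by (rule bdd_above_mono) auto
  show "(SUP n. f (d n)) \<le> (SUP x. f x)"
    using bdd by (intro cSUP_least cSUP_upper) auto
  show "(SUP x. f x) \<le> (SUP n. f (d n))"
  proof (rule cSUP_least)
    fix x
    show "f x \<le> (SUP n. f (d n))"
    proof (rule ccontr)
      assume "\<not> ?thesis"
      moreover have "open {y. (SUP n. f (d n)) < f y}"
        by (intro open_Collect_less continuous_on_const f)
      ultimately obtain m where "(SUP n. f (d n)) < f (d m)"
        using dense[of "{y. (SUP n. f (d n)) < f y}" x] by auto
      then show False
        using cSUP_upper[OF UNIV_I bdd', of m] by simp
    qed
  qed simp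
qed

section \<open>Centred sections and their Gram kernel\<close>

context continuous_rkhs
begin

definition centered :: "'a measure \<Rightarrow> 'a \<Rightarrow> 'a \<Rightarrow> real" where
  "centered P x = (\<lambda>z. k z x - kernel_mean_embedding H ip k P z)"

text \<open>The Gram kernel of the \<open>\<psi> x\<close>, which later instantiates
  \<open>g\<close> in \<open>iid_degenerate_kernel\<close>.\<close>

definition centered_kernel :: "'a measure \<Rightarrow> 'a \<Rightarrow> 'a \<Rightarrow> real" where
  "centered_kernel P x y = ip (centered P x) (centered P y)"

context
  fixes P :: "'a measure"
  assumes prob_P: "prob_space P" and sets_P: "sets P = sets borel"
begin

interpretation P: prob_space P
  by (rule prob_P)

lemma P_measure: "finite_measure P" "sets P = sets borel"
  by (fact P.finite_measure_axioms sets_P)+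

lemmas mean_mem = kernel_mean_embedding_mem[OF P_measure]
lemmas mean_inner = kernel_mean_embedding_inner[OF P_measure]
lemmas mean_eq = kernel_mean_embedding_eq[OF P_measure]

lemma centered_mem: "centered P x \<in> H"
  unfolding centered_def by (intro diff_mem section_mem mean_mem)

lemma centered_kernel_eq:
  "centered_kernel P x y = k x y - kernel_mean_embedding H ip k P x - kernel_mean_embedding H ip k P y
     + ip (kernel_mean_embedding H ip k P) (kernel_mean_embedding H ip k P)"
  unfolding centered_kernel_def centered_def
  by (simp add: ip_diff_left ip_diff_right diff_mem section_mem mean_mem ip_sections
      kernel_sym[of y x] ip_commute[OF section_mem mean_mem] flip: reproducing[OF mean_mem])

text \<open>Bilinearity. General coefficients give positive definiteness; coefficients
  \<open>1\<close> identify the quadratic form with a squared norm.\<close>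

lemma sum_centered_kernel:
  assumes "finite I"
  shows "(\<Sum>i\<in>I. \<Sum>j\<in>I. a i * a j * centered_kernel P (x i) (x j))
    = ip (\<lambda>z. \<Sum>i\<in>I. a i * centered P (x i) z) (\<lambda>z. \<Sum>i\<in>I. a i * centered P (x i) z)"
proof -
  have "ip (\<lambda>z. \<Sum>i\<in>I. a i * centered P (x i) z) f = (\<Sum>i\<in>I. a i * ip (centered P (x i)) f)"
    if "f \<in> H" for f
    using that by (simp add: ip_sum_left[OF scale_mem] centered_mem ip_scale_left)
  moreover have "ip (centered P (x i)) (\<lambda>z. \<Sum>i\<in>I. a i * centered P (x i) z)
      = (\<Sum>j\<in>I. a j * centered_kernel P (x i) (x j))" for i
  proof -
    have mem: "(\<lambda>z. \<Sum>i\<in>I. a i * centered P (x i) z) \<in> H"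
      by (intro sum_mem scale_mem centered_mem)
    show ?thesis
      unfolding ip_commute[OF centered_mem mem]
      using centered_mem by (simp add: ip_sum_left[OF scale_mem] ip_scale_left centered_kernel_def
          ip_commute[OF centered_mem centered_mem, of _ "x i"])
  qed
  ultimately show ?thesis
    by (simp add: sum_mem scale_mem centered_mem sum_distrib_left mult.assoc)
qed

lemma is_kernel_centered: "is_kernel (centered_kernel P)"
  unfolding is_kernel_def
  by (auto simp: sum_centered_kernel intro!: ip_nonneg sum_mem scale_mem centered_mem)
     (simp add: centered_kernel_def ip_commute[OF centered_mem centered_mem])

lemma mean_bound: "\<bar>kernel_mean_embedding H ip k P x\<bar> \<le> C"
proof -
  have "\<bar>kernel_mean_embedding H ip k P x\<bar> \<le> (\<integral>y. \<bar>k y x\<bar> \<partial>P)"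
    unfolding mean_eq by (rule integral_abs_bound)
  also have "\<dots> \<le> (\<integral>y. C \<partial>P)"
    using mem_integrable[OF section_mem P_measure] kernel_bound
    by (intro integral_mono integrable_abs) auto
  finally show ?thesis
    by (simp add: P.prob_space)
qed

text \<open>Each of the four terms in \<open>centered_kernel_eq\<close> contributes at most
  \<open>C\<close>, whence the norm bound \<open>2 * sqrt C\<close>.\<close>

lemma centered_kernel_diag_le: "centered_kernel P x x \<le> (2 * sqrt C)\<^sup>2"
proof -
  have "ip (kernel_mean_embedding H ip k P) (kernel_mean_embedding H ip k P) \<le> (\<integral>y. C \<partial>P)"
    unfolding mean_inner[OF mean_mem] using mem_integrable[OF mean_mem P_measure] mean_bound
    by (intro integral_mono) (auto simp: abs_le_iff)
  then have "ip (kernel_mean_embedding H ip k P) (kernel_mean_embedding H ip k P) \<le> C"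
    by (simp add: P.prob_space)
  then show ?thesis
    using kernel_bound[of x x] mean_bound[of x] C_pos
    by (simp add: centered_kernel_eq power_mult_distrib abs_le_iff)
qed

lemma measurable_centered_kernel:
  "(\<lambda>p. centered_kernel P (fst p) (snd p)) \<in> borel_measurable (borel \<Otimes>\<^sub>M borel)"
proof -
  have [measurable]: "kernel_mean_embedding H ip k P \<in> borel_measurable borel"
    by (rule mem_measurable[OF mean_mem])
  show ?thesis
    unfolding centered_kernel_eq using measurable_kernel by measurable
qed

text \<open>By the reproducing property the integrand is \<open>\<psi> x\<close> minus a constant,
  and pairing with the embedding shows this constant to be the mean of \<open>\<psi> x\<close> under
  \<open>P\<close>.\<close>

lemma centered_kernel_degenerate: "(\<integral>y. centered_kernel P x y \<partial>P) = 0"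
proof -
  define m where "m = ip (centered P x) (kernel_mean_embedding H ip k P)"
  have eq: "centered_kernel P x y = centered P x y - m" for y
  proof -
    have "centered_kernel P x y = ip (centered P x) (\<lambda>z. k z y - kernel_mean_embedding H ip k P z)"
      by (simp add: centered_kernel_def centered_def[of P y])
    also have "\<dots> = ip (centered P x) (\<lambda>z. k z y) - m"
      unfolding m_def by (rule ip_diff_right[OF section_mem mean_mem centered_mem])
    also have "ip (centered P x) (\<lambda>z. k z y) = centered P x y"
      by (rule reproducing[OF centered_mem, symmetric])
    finally show ?thesis .
  qed
  have "m = integral\<^sup>L P (centered P x)"
    unfolding m_def ip_commute[OF centered_mem mean_mem] by (rule mean_inner[OF centered_mem])
  then show ?thesis
    unfolding eq using mem_integrable[OF centered_mem P_measure] by (simp add: P.prob_space)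
qed

text \<open>The error is the function \<open>S / n\<close> in \<open>H\<close>, and
  \<open>mem_bound\<close> controls its values by its norm, uniformly in \<open>z\<close>.\<close>

lemma embedding_error_le:
  assumes n: "1 \<le> n"
  shows "\<bar>kernel_mean_embedding H ip k (empirical_measure x n) z - kernel_mean_embedding H ip k P z\<bar>
    \<le> sqrt C * sqrt (\<Sum>i=1..n. \<Sum>j=1..n. centered_kernel P (x i) (x j)) / n"
proof -
  interpret E: prob_space "empirical_measure x n"
    using n by (rule prob_space_empirical_measure)
  define S where "S = (\<lambda>z. \<Sum>i=1..n. centered P (x i) z)"
  have S: "S \<in> H"
    unfolding S_def by (intro sum_mem centered_mem)
  have "kernel_mean_embedding H ip k (empirical_measure x n) z = (\<Sum>i=1..n. k z (x i)) / n"
    using n by (simp add: kernel_mean_embedding_eq[OF E.finite_measure_axioms] integral_empirical_measure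
        kernel_sym[of z])
  then have "kernel_mean_embedding H ip k (empirical_measure x n) z - kernel_mean_embedding H ip k P z = S z / n"
    using n by (simp add: S_def centered_def sum_subtractf field_simps)
  moreover have "nrm S = sqrt (\<Sum>i=1..n. \<Sum>j=1..n. centered_kernel P (x i) (x j))"
    using sum_centered_kernel[of "{1..n}" "\<lambda>_. 1" x] by (simp add: S_def inner_norm_def)
  ultimately show ?thesis
    using mem_bound[OF S, of z] n by (simp add: divide_right_mono mult.commute)
qed

end

end

theorem theorem5:
  fixes k :: "'a::topological_space \<Rightarrow> 'a \<Rightarrow> real"
    and H :: "('a \<Rightarrow> real) set"
    and ip :: "('a \<Rightarrow> real) \<Rightarrow> ('a \<Rightarrow> real) \<Rightarrow> real"
    and P :: "'a measure"
    and M :: "'w measure"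
    and X :: "nat \<Rightarrow> 'w \<Rightarrow> 'a"
  assumes "separable_space (euclidean :: 'a topology)"
    and "is_kernel k"
    and "bounded (range (\<lambda>(x, y). k x y))"
    and "continuous_on UNIV (\<lambda>(x, y). k x y)"
    and "is_rkhs k H ip"
    and "prob_space P" and "sets P = sets borel"
    and "prob_space M"
    and "prob_space.indep_vars M (\<lambda>_. borel) X {1..}"
    and "\<And>i. i \<ge> 1 \<Longrightarrow> distr M borel (X i) = P"
  shows "bigo_aco M
           (\<lambda>n \<omega>. SUP x. \<bar>kernel_mean_embedding H ip k (empirical_measure (\<lambda>i. X i \<omega>) n) x
                          - kernel_mean_embedding H ip k P x\<bar>)
           (\<lambda>_. 0)
           (\<lambda>n. sqrt (ln (real n) / real n))"
proof -
  obtain C where C: "0 < C" "\<And>x y. \<bar>k x y\<bar> \<le> C"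
    using assms(3) unfolding bounded_pos by auto
  obtain d :: "nat \<Rightarrow> 'a" where d: "\<And>x S. open S \<Longrightarrow> x \<in> S \<Longrightarrow> \<exists>n. d n \<in> S"
    using separable_space_dense_sequence[OF assms(1)] by blast
  interpret continuous_rkhs H ip k C d
    using assms(4,5) C d by unfold_locales (auto simp: is_rkhs_def)
  interpret M: prob_space M
    by fact
  note P = assms(6,7)
  interpret iid_degenerate_kernel M borel P X "centered_kernel P" "2 * sqrt C"
    using assms(9,10) C(1) is_kernel_centered[OF P] measurable_centered_kernel[OF P]
      centered_kernel_diag_le[OF P] centered_kernel_degenerate[OF P]
    by unfold_locales auto
  let ?E = "\<lambda>n \<omega> x. \<bar>kernel_mean_embedding H ip k (empirical_measure (\<lambda>i. X i \<omega>) n) x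
    - kernel_mean_embedding H ip k P x\<bar>"
  have le: "?E n \<omega> x \<le> sqrt C * sqrt (quad n (\<lambda>i. X i \<omega>)) / n" if "1 \<le> n" for n \<omega> x
    unfolding quad_def using that by (rule embedding_error_le[OF P])
  have bdd: "bdd_above (range (?E n \<omega>))" if "1 \<le> n" for n \<omega>
    using le[OF that] by (intro bdd_aboveI2)
  have SUP_eq: "(SUP x. ?E n \<omega> x) = (SUP m. ?E n \<omega> (d m))" if n: "1 \<le> n" for n \<omega>
  proof (rule SUP_dense_sequence[OF _ bdd[OF n] dense])
    interpret E: prob_space "empirical_measure (\<lambda>i. X i \<omega>) n"
      using n by (rule prob_space_empirical_measure)
    show "continuous_on UNIV (?E n \<omega>)"
      by (intro continuous_intros mem_continuous kernel_mean_embedding_mem[OF E.finite_measure_axioms]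
          mean_mem[OF P]) simp
  qed
  have measurable_SUP: "(\<lambda>\<omega>. SUP x. ?E n \<omega> x) \<in> borel_measurable M" if n: "1 \<le> n" for n
    unfolding SUP_eq[OF n]
  proof (rule borel_measurable_cSUP)
    fix m
    have "kernel_mean_embedding H ip k (empirical_measure (\<lambda>i. X i \<omega>) n) (d m)
        = (\<Sum>i=1..n. k (X i \<omega>) (d m)) / n" for \<omega>
      using n by (simp add: kernel_mean_embedding_eq integral_empirical_measure
          prob_space.finite_measure prob_space_empirical_measure)
    moreover have "(\<lambda>\<omega>. \<Sum>i=1..n. k (X i \<omega>) (d m)) \<in> borel_measurable M"
      by (intro borel_measurable_sum measurable_compose[OF measurable_X measurable_kernel_section]) auto
    ultimately show "(\<lambda>\<omega>. ?E n \<omega> (d m)) \<in> borel_measurable M"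
      by simp
    show "bdd_above (range (\<lambda>m. ?E n \<omega> (d m)))" for \<omega>
      using le[OF n] by (intro bdd_aboveI2)
  qed simp
  have tail: "measure M {\<omega> \<in> space M. \<bar>(SUP x. ?E n \<omega> x) - 0\<bar> > sqrt (ln n / n) * (8 * C)}
      \<le> 2 * inverse (real n ^ 4)" if n: "1 \<le> n" for n
  proof -
    \<comment> \<open>The threshold for \<open>\<parallel>S\<^sub>n\<parallel>\<close> that
      corresponds to the constant \<open>8 * C\<close>. It makes the exponent of the tail bound
      equal to \<open>- (4 * ln n)\<close>, which leaves a summable power of
      \<open>n\<close>.\<close>
    define t where "t = 8 * sqrt C * sqrt (n * ln n)"
    have t: "0 \<le> t"
      using C n by (simp add: t_def)
    have "{\<omega> \<in> space M. \<bar>(SUP x. ?E n \<omega> x) - 0\<bar> > sqrt (ln n / n) * (8 * C)}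
        \<subseteq> {\<omega> \<in> space M. t < sqrt (quad n (\<lambda>i. X i \<omega>))}"
    proof safe
      fix \<omega>
      assume gt: "\<bar>(SUP x. ?E n \<omega> x) - 0\<bar> > sqrt (ln n / n) * (8 * C)"
      \<comment> \<open>Nonnegativity of the supremum removes the outer absolute value.\<close>
      have "0 \<le> ?E n \<omega> (d 0)"
        by simp
      also have "\<dots> \<le> (SUP x. ?E n \<omega> x)"
        using bdd[OF n] by (rule cSUP_upper[OF UNIV_I])
      finally have "sqrt (ln n / n) * (8 * C) < (SUP x. ?E n \<omega> x)"
        using gt by simp
      also have "\<dots> \<le> sqrt C * sqrt (quad n (\<lambda>i. X i \<omega>)) / n"
        using le[OF n] by (intro cSUP_least) auto
      finally have "n * (sqrt (ln n / n) * (8 * C)) < sqrt C * sqrt (quad n (\<lambda>i. X i \<omega>))"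
        using n by (simp add: field_simps)
      also have "n * (sqrt (ln n / n) * (8 * C)) = sqrt C * t"
      proof -
        have "n * ln n = (real n)\<^sup>2 * (ln n / n)"
          using n by (simp add: power2_eq_square)
        then have "sqrt (n * ln n) = n * sqrt (ln n / n)"
          by (simp only: real_sqrt_mult real_sqrt_abs abs_of_nat)
        then show ?thesis
          using C(1) by (simp add: t_def)
      qed
      finally have "sqrt C * t < sqrt C * sqrt (quad n (\<lambda>i. X i \<omega>))" .
      then show "t < sqrt (quad n (\<lambda>i. X i \<omega>))"
        using C by simp
    qed
    \<comment> \<open>Monotonicity of the measure asks for measurability of the larger
      event.\<close>
    moreover have "(\<lambda>\<omega>. quad n (\<lambda>i. X i \<omega>)) \<in> borel_measurable M"
      by (rule measurable_quad) measurable
    then have "{\<omega> \<in> space M. t < sqrt (quad n (\<lambda>i. X i \<omega>))} \<in> sets M"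
      by measurable
    ultimately have "measure M {\<omega> \<in> space M. \<bar>(SUP x. ?E n \<omega> x) - 0\<bar> > sqrt (ln n / n) * (8 * C)}
        \<le> measure M {\<omega> \<in> space M. t < sqrt (quad n (\<lambda>i. X i \<omega>))}"
      by (rule M.finite_measure_mono)
    also have "\<dots> \<le> 2 * exp (- (t\<^sup>2 / (4 * real n * (2 * sqrt C)\<^sup>2)))"
      using n t by (rule prob_sqrt_quad_gt_le)
    also have "t\<^sup>2 / (4 * real n * (2 * sqrt C)\<^sup>2) = 4 * ln n"
      using n C by (simp add: t_def power_mult_distrib)
    also have "exp (- (4 * ln n)) = inverse (real n ^ 4)"
      using n exp_of_nat_mult[of 4 "ln (real n)"] by (simp add: exp_minus)
    finally show ?thesis .
  qed
  \<comment> \<open>The shift to \<open>Suc n\<close> matches the series in \<open>bigo_aco\<close>,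
    which starts at sample size \<open>1\<close>.\<close>
  have "summable (\<lambda>n. 2 * inverse (real (Suc n) ^ 4))"
    using inverse_power_summable[of 4, where ?'a = real]
    by (intro summable_mult) (subst summable_Suc_iff, simp)
  then have "summable (\<lambda>n. measure M {\<omega> \<in> space M.
      \<bar>(SUP x. ?E (Suc n) \<omega> x) - 0\<bar> > sqrt (ln (real (Suc n)) / real (Suc n)) * (8 * C)})"
  proof (rule summable_comparison_test'[where N = 0])
    fix n :: nat
    show "norm (measure M {\<omega> \<in> space M.
        \<bar>(SUP x. ?E (Suc n) \<omega> x) - 0\<bar> > sqrt (ln (real (Suc n)) / real (Suc n)) * (8 * C)})
        \<le> 2 * inverse (real (Suc n) ^ 4)"
      using tail[of "Suc n"] by simp
  qed
  moreover have "(\<lambda>n. sqrt (ln (real n) / real n)) \<longlonglongrightarrow> 0"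
    using tendsto_real_sqrt[OF lim_ln_over_n] by simp
  ultimately show ?thesis
    unfolding bigo_aco_def using measurable_SUP C(1)
    by (intro conjI exI[of _ "8 * C"]) auto
qed

end
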